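(* Let $(\Omega,\mathcal{H},U_f,\hat{\mathbb{E}})$ be a regular sublinear expectation system, where $U_f$ is the operator $U_fX=X\circ f$ induced by a measurable transformation $f:\Omega\to\Omega$. For $X\in\mathcal{H}$ put $$\overline X:=\limsup_{n\to\infty}\frac1n\sum_{i=0}^{n-1}U_f^iX,\qquad\underline X:=\liminf_{n\to\infty}\frac1n\sum_{i=0}^{n-1}U_f^iX .$$ Then for any $X\in\mathcal{H}$ with $\overline X,\underline X\in\mathcal{H}$ there exists $X^*\in\mathcal{H}$ with $U_fX^*=X^*$, $\hat{\mathbb{E}}$-q.s., such that $$\lim_{n\to\infty}\frac1n\sum_{i=0}^{n-1}U_f^iX=X^*,\quad\hat{\mathbb{E}}\text{-q.s.}$$ Moreover, the following two statements are equivalent: (i) $\hat{\mathbb{E}}$ is ergodic; (ii) for any $X\in\mathcal{H}$ with $\overline X,\underline X\in\mathcal{H}$ there exists a constant $c_X\in\mathbb{R}$ such that $\lim_{n\to\infty}\frac1n\sum_{i=0}^{n-1}U_f^iX=c_X$, $\hat{\mathbb{E}}$-q.s. If one of these two equivalent statements holds, then for any $f$-invariant probability $P\in\mathcal{P}$ and any $X\in\mathcal{H}$ with $\overline X,\underline X\in\mathcal{H}$, one has $\int X\,dP=c_X$.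
   Context: $\Omega$ is a nonempty set and $\mathcal{H}$ is a vector lattice of real-valued functions on $\Omega$: a linear space containing the constants and containing $|X|$ whenever it contains $X$ (no closure under Lipschitz functions is assumed here). A sublinear expectation is a functional $\hat{\mathbb{E}}:\mathcal{H}\to\mathbb{R}$ that is monotone, preserves constants, is sub-additive and positively homogeneous. It is regular if $\hat{\mathbb{E}}[X_i]\to0$ whenever $X_i\in\mathcal{H}$ decrease pointwise to $0$. A (discrete-time) sublinear expectation system $(\Omega,\mathcal{H},U,\hat{\mathbb{E}})$ consists of such data with a linear operator $U:\mathcal{H}\to\mathcal{H}$ satisfying $\hat{\mathbb{E}}[UX]=\hat{\mathbb{E}}[X]$ for all $X\in\mathcal{H}$. Measurability of $f$ is with respect to $\sigma(\mathcal{H})$. $\mathcal{P}$ is the set of all probabilities $P$ on $(\Omega,\sigma(\mathcal{H}))$ with $\int X\,dP\le\hat{\mathbb{E}}[X]$ for all $X\in\mathcal{H}$; in the regular case $\hat{\mathbb{E}}[X]=\sup_{P\in\mathcal{P}}\int X\,dP$ for $X\in\mathcal{H}$. A property holds $\hat{\mathbb{E}}$-q.s. if it holds on some $A\in\sigma(\mathcal{H})$ with $\sup_{P\in\mathcal{P}}P(A^c)=0$. The system (or $\hat{\mathbb{E}}$) is ergodic if every $X\in\mathcal{H}$ with $UX=X$, $\hat{\mathbb{E}}$-q.s., is constant, $\hat{\mathbb{E}}$-q.s. A probability $P$ is ($f$-)invariant if $P(f^{-1}A)=P(A)$ for all $A\in\sigma(\mathcal{H})$.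
   Formalization: The condition that the upper and lower time averages belong to H is read quasi-surely (each agrees q.s. with some element of H), since with pointwise membership (ii) does not imply (i), e.g. H = C[0,1], f(x) = x², E[X] = max(X(0), X(1)). *)

theory Defs
  imports "HOL-Probability.Probability"
begin

text \<open>
  The nonempty set \<open>\<Omega>\<close> is the universe of a type \<open>'a\<close>. A functional on \<open>\<H>\<close> is a total function
  on \<open>'a \<Rightarrow> real\<close> about which nothing is assumed outside \<open>H\<close>.
\<close>

definition vector_lattice :: "('a \<Rightarrow> real) set \<Rightarrow> bool" where
  "vector_lattice H \<longleftrightarrow>
     (\<forall>c. (\<lambda>_. c) \<in> H) \<and>
     (\<forall>X\<in>H. \<forall>Y\<in>H. (\<lambda>\<omega>. X \<omega> + Y \<omega>) \<in> H) \<and>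
     (\<forall>X\<in>H. \<forall>c. (\<lambda>\<omega>. c * X \<omega>) \<in> H) \<and>
     (\<forall>X\<in>H. (\<lambda>\<omega>. \<bar>X \<omega>\<bar>) \<in> H)"

definition sublinear_expectation :: "('a \<Rightarrow> real) set \<Rightarrow> (('a \<Rightarrow> real) \<Rightarrow> real) \<Rightarrow> bool" where
  "sublinear_expectation H E \<longleftrightarrow>
     (\<forall>X\<in>H. \<forall>Y\<in>H. (\<forall>\<omega>. X \<omega> \<le> Y \<omega>) \<longrightarrow> E X \<le> E Y) \<and>
     (\<forall>c. E (\<lambda>_. c) = c) \<and>
     (\<forall>X\<in>H. \<forall>Y\<in>H. E (\<lambda>\<omega>. X \<omega> + Y \<omega>) \<le> E X + E Y) \<and>
     (\<forall>X\<in>H. \<forall>c\<ge>0. E (\<lambda>\<omega>. c * X \<omega>) = c * E X)"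

definition regular_expectation :: "('a \<Rightarrow> real) set \<Rightarrow> (('a \<Rightarrow> real) \<Rightarrow> real) \<Rightarrow> bool" where
  "regular_expectation H E \<longleftrightarrow>
     (\<forall>X::nat \<Rightarrow> 'a \<Rightarrow> real.
        (\<forall>i. X i \<in> H) \<longrightarrow> (\<forall>\<omega>. decseq (\<lambda>i. X i \<omega>) \<and> (\<lambda>i. X i \<omega>) \<longlonglongrightarrow> 0) \<longrightarrow>
        (\<lambda>i. E (X i)) \<longlonglongrightarrow> 0)"

definition linear_operator_on :: "('a \<Rightarrow> real) set \<Rightarrow> (('a \<Rightarrow> real) \<Rightarrow> ('a \<Rightarrow> real)) \<Rightarrow> bool" where
  "linear_operator_on H U \<longleftrightarrow>
     (\<forall>X\<in>H. U X \<in> H) \<and>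
     (\<forall>X\<in>H. \<forall>Y\<in>H. U (\<lambda>\<omega>. X \<omega> + Y \<omega>) = (\<lambda>\<omega>. U X \<omega> + U Y \<omega>)) \<and>
     (\<forall>X\<in>H. \<forall>c. U (\<lambda>\<omega>. c * X \<omega>) = (\<lambda>\<omega>. c * U X \<omega>))"

definition sublinear_expectation_system ::
  "('a \<Rightarrow> real) set \<Rightarrow> (('a \<Rightarrow> real) \<Rightarrow> ('a \<Rightarrow> real)) \<Rightarrow> (('a \<Rightarrow> real) \<Rightarrow> real) \<Rightarrow> bool" where
  "sublinear_expectation_system H U E \<longleftrightarrow>
     vector_lattice H \<and> sublinear_expectation H E \<and> linear_operator_on H U \<and>
     (\<forall>X\<in>H. E (U X) = E X)"

definition koopman :: "('a \<Rightarrow> 'a) \<Rightarrow> ('a \<Rightarrow> real) \<Rightarrow> ('a \<Rightarrow> real)" where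
  "koopman f X = X \<circ> f"

definition sigmaH :: "('a \<Rightarrow> real) set \<Rightarrow> 'a measure" where
  "sigmaH H = sigma UNIV {X -` B |X B. X \<in> H \<and> B \<in> sets borel}"

text \<open>
  Integrability is stated because Bochner integrals of non-integrable functions are \<open>0\<close> by
  convention. Mathematically it is no restriction: \<open>\<bar>X\<bar> \<in> H\<close> and \<open>\<integral>\<bar>X\<bar> dP \<le> E \<bar>X\<bar> < \<infinity>\<close>.
\<close>

definition dominated_probs :: "('a \<Rightarrow> real) set \<Rightarrow> (('a \<Rightarrow> real) \<Rightarrow> real) \<Rightarrow> 'a measure set" where
  "dominated_probs H E =
     {P. prob_space P \<and> sets P = sets (sigmaH H) \<and>
         (\<forall>X\<in>H. integrable P X \<and> (\<integral>\<omega>. X \<omega> \<partial>P) \<le> E X)}"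

definition quasi_surely ::
  "('a \<Rightarrow> real) set \<Rightarrow> (('a \<Rightarrow> real) \<Rightarrow> real) \<Rightarrow> ('a \<Rightarrow> bool) \<Rightarrow> bool" where
  "quasi_surely H E Q \<longleftrightarrow>
     (\<exists>A\<in>sets (sigmaH H). (\<forall>\<omega>\<in>A. Q \<omega>) \<and> (SUP P\<in>dominated_probs H E. emeasure P (- A)) = 0)"

definition ergodic_system ::
  "('a \<Rightarrow> real) set \<Rightarrow> (('a \<Rightarrow> real) \<Rightarrow> ('a \<Rightarrow> real)) \<Rightarrow> (('a \<Rightarrow> real) \<Rightarrow> real) \<Rightarrow> bool" where
  "ergodic_system H U E \<longleftrightarrow>
     (\<forall>X\<in>H. quasi_surely H E (\<lambda>\<omega>. U X \<omega> = X \<omega>) \<longrightarrow>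
        (\<exists>c. quasi_surely H E (\<lambda>\<omega>. X \<omega> = c)))"

definition invariant_prob :: "('a \<Rightarrow> real) set \<Rightarrow> ('a \<Rightarrow> 'a) \<Rightarrow> 'a measure \<Rightarrow> bool" where
  "invariant_prob H f P \<longleftrightarrow> (\<forall>A\<in>sets (sigmaH H). measure P (f -` A) = measure P A)"

definition time_average ::
  "(('a \<Rightarrow> real) \<Rightarrow> ('a \<Rightarrow> real)) \<Rightarrow> ('a \<Rightarrow> real) \<Rightarrow> nat \<Rightarrow> 'a \<Rightarrow> real" where
  "time_average U X n \<omega> = (1 / real n) * (\<Sum>i<n. (U ^^ i) X \<omega>)"

definition upper_average ::
  "(('a \<Rightarrow> real) \<Rightarrow> ('a \<Rightarrow> real)) \<Rightarrow> ('a \<Rightarrow> real) \<Rightarrow> 'a \<Rightarrow> ereal" where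
  "upper_average U X \<omega> = limsup (\<lambda>n. ereal (time_average U X n \<omega>))"

definition lower_average ::
  "(('a \<Rightarrow> real) \<Rightarrow> ('a \<Rightarrow> real)) \<Rightarrow> ('a \<Rightarrow> real) \<Rightarrow> 'a \<Rightarrow> ereal" where
  "lower_average U X \<omega> = liminf (\<lambda>n. ereal (time_average U X n \<omega>))"

text \<open>
  Membership in \<open>\<H>\<close> of an extended-real function such as \<open>upper_average U X\<close>: like every other
  relation between functions here, it is understood quasi-surely, i.e. the function agrees
  q.s. with a (real-valued) element of \<open>H\<close>.

  Pitfall: if membership were required at every point, \<open>time averages of admissible X are
  constant\<close> would not imply ergodicity, where \<open>U X = X\<close> is only required q.s. Take
  \<open>\<Omega> = [0,1]\<close>, \<open>H = C[0,1]\<close>, \<open>f x = x\<^sup>2\<close> and \<open>E X = max (X 0) (X 1)\<close>. The time averages of \<open>X\<close>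
  tend to \<open>X 0\<close> on \<open>[0,1)\<close> and to \<open>X 1\<close> at \<open>1\<close>; this limit is continuous only if \<open>X 0 = X 1\<close>,
  and then it is constant. But \<open>X x = x\<close> satisfies \<open>X \<circ> f = X\<close> on \<open>{0,1}\<close>, hence q.s., and is
  not q.s. constant. Pointwise membership implies q.s. membership (lemma
  below), so results proved for q.s. members hold in particular for pointwise members.
\<close>

definition qs_member ::
  "('a \<Rightarrow> real) set \<Rightarrow> (('a \<Rightarrow> real) \<Rightarrow> real) \<Rightarrow> ('a \<Rightarrow> ereal) \<Rightarrow> bool" where
  "qs_member H E F \<longleftrightarrow> (\<exists>Y\<in>H. quasi_surely H E (\<lambda>\<omega>. F \<omega> = ereal (Y \<omega>)))"

lemma qs_memberI_pointwise:
  assumes "Y \<in> H" and "\<And>\<omega>. F \<omega> = ereal (Y \<omega>)"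
  shows "qs_member H E F"
proof -
  have "(SUP P\<in>dominated_probs H E. emeasure P (- UNIV)) = 0"
    by (cases "dominated_probs H E = {}") (auto simp: bot_ennreal)
  moreover have "UNIV \<in> sets (sigmaH H)"
    using sets.top[of "sigmaH H"] by (simp add: sigmaH_def)
  ultimately have "quasi_surely H E (\<lambda>\<omega>. F \<omega> = ereal (Y \<omega>))"
    unfolding quasi_surely_def using assms(2) by blast
  with assms(1) show ?thesis
    unfolding qs_member_def by blast
qed

end

theory Submission
  imports Defs
begin

text \<open>
  Let \<open>Y\<close> and \<open>Z\<close> be elements of \<open>H\<close> representing the upper and the lower time average of \<open>X\<close>; they
  are invariant q.s. Given \<open>P\<close> dominated by \<open>E\<close>, a limit point of the Cesaro means of \<open>P \<circ> f\<^sup>-\<^sup>n\<close>,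
  taken as functionals on \<open>H\<close>, is an invariant linear functional dominated by \<open>E\<close>. By regularity
  and the Daniell-Stone theorem it is integration against a probability \<open>Q\<close> dominated by \<open>E\<close>,
  and \<open>Q\<close> gives \<open>Y - Z\<close> the same integral as \<open>P\<close> does. The maximal ergodic inequality for \<open>Q\<close>
  yields \<open>\<integral>Y dQ \<le> \<integral>X dQ \<le> \<integral>Z dQ\<close>, hence \<open>\<integral>(Y - Z) dP \<le> 0\<close> and \<open>Y = Z\<close> almost surely for \<open>P\<close>.
\<close>

section \<open>The Daniell-Stone theorem\<close>

locale function_lattice =
  fixes H :: "('a \<Rightarrow> real) set"
  assumes vector_lattice: "vector_lattice H"
begin

lemma const_in: "(\<lambda>_. c) \<in> H"
  and add_in: "X \<in> H \<Longrightarrow> Y \<in> H \<Longrightarrow> (\<lambda>\<omega>. X \<omega> + Y \<omega>) \<in> H"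
  and scale_in: "X \<in> H \<Longrightarrow> (\<lambda>\<omega>. c * X \<omega>) \<in> H"
  and abs_in: "X \<in> H \<Longrightarrow> (\<lambda>\<omega>. \<bar>X \<omega>\<bar>) \<in> H"
  using vector_lattice by (auto simp: vector_lattice_def)

lemma uminus_in: "X \<in> H \<Longrightarrow> (\<lambda>\<omega>. - X \<omega>) \<in> H"
  using scale_in[of X "-1"] by simp

lemma diff_in: "X \<in> H \<Longrightarrow> Y \<in> H \<Longrightarrow> (\<lambda>\<omega>. X \<omega> - Y \<omega>) \<in> H"
  using add_in[OF _ uminus_in, of X Y] by simp

lemma max_in:
  assumes "X \<in> H" "Y \<in> H" shows "(\<lambda>\<omega>. max (X \<omega>) (Y \<omega>)) \<in> H"
proof -
  have "(\<lambda>\<omega>. (1/2) * ((X \<omega> + Y \<omega>) + \<bar>X \<omega> - Y \<omega>\<bar>)) \<in> H"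
    by (intro scale_in add_in abs_in diff_in assms)
  also have "(\<lambda>\<omega>. (1/2) * ((X \<omega> + Y \<omega>) + \<bar>X \<omega> - Y \<omega>\<bar>)) = (\<lambda>\<omega>. max (X \<omega>) (Y \<omega>))"
    by (auto simp: max_def)
  finally show ?thesis .
qed

lemma min_in:
  assumes "X \<in> H" "Y \<in> H" shows "(\<lambda>\<omega>. min (X \<omega>) (Y \<omega>)) \<in> H"
  using uminus_in[OF max_in[OF uminus_in[OF assms(1)] uminus_in[OF assms(2)]]]
  by (simp add: minus_max_eq_min)

lemma sum_in:
  "finite I \<Longrightarrow> (\<And>i. i \<in> I \<Longrightarrow> X i \<in> H) \<Longrightarrow> (\<lambda>\<omega>. \<Sum>i\<in>I. X i \<omega>) \<in> H"
proof (induction I rule: finite_induct)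
  case empty
  then show ?case by (simp add: const_in)
next
  case (insert a I)
  then show ?case using add_in[of "X a" "\<lambda>\<omega>. \<Sum>i\<in>I. X i \<omega>"] by simp
qed

lemmas lattice_intros = const_in add_in scale_in abs_in uminus_in diff_in max_in min_in

lemma space_sigmaH [simp]: "space (sigmaH H) = UNIV"
  by (simp add: sigmaH_def)

lemma measurable_in:
  assumes "X \<in> H" shows "X \<in> borel_measurable (sigmaH H)"
proof (rule measurableI)
  fix A :: "real set" assume "A \<in> sets borel"
  with assms show "X -` A \<inter> space (sigmaH H) \<in> sets (sigmaH H)"
    by (auto simp: sigmaH_def intro!: in_measure_of)
qed simp

lemma measurable_into_sigmaH:
  assumes "\<And>X. X \<in> H \<Longrightarrow> (\<lambda>z. X (g z)) \<in> borel_measurable M"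
  shows "g \<in> measurable M (sigmaH H)"
  unfolding sigmaH_def
proof (rule measurable_measure_of)
  fix A assume "A \<in> {X -` B |X B. X \<in> H \<and> B \<in> sets borel}"
  then obtain X B where XB: "A = X -` B" "X \<in> H" "B \<in> sets borel" by auto
  have "g -` A \<inter> space M = (\<lambda>z. X (g z)) -` B \<inter> space M"
    using XB by auto
  then show "g -` A \<inter> space M \<in> sets M"
    using assms[OF XB(2)] XB(3) by (simp add: measurable_sets)
qed auto

end

text \<open>
  Kindler's proof of the Daniell-Stone theorem: the strips \<open>{(\<omega>, t). X \<omega> \<le> t < Y \<omega>}\<close> form a
  semiring on which \<open>L (Y - X)\<close> is a premeasure, and the representing measure of \<open>A\<close> is the
  measure of \<open>A \<times> [0, 1)\<close>.
\<close>

definition strip :: "('a \<Rightarrow> real) \<Rightarrow> ('a \<Rightarrow> real) \<Rightarrow> ('a \<times> real) set" where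
  "strip X Y = {(\<omega>, t). X \<omega> \<le> t \<and> t < Y \<omega>}"

text \<open>Defined through vertical sections so that it depends on the set alone: different pairs
  \<open>X\<close>, \<open>Y\<close> can describe the same strip.\<close>

definition height :: "('a \<times> real) set \<Rightarrow> 'a \<Rightarrow> real" where
  "height A \<omega> = measure lborel {t. (\<omega>, t) \<in> A}"

lemma section_strip: "{t. (\<omega>, t) \<in> strip X Y} = {X \<omega>..<Y \<omega>}"
  by (auto simp: strip_def)

lemma height_strip: "height (strip X Y) \<omega> = max 0 (Y \<omega> - X \<omega>)"
  unfolding height_def section_strip by (cases "X \<omega> \<le> Y \<omega>") auto

locale daniell_integral = function_lattice H for H :: "('a \<Rightarrow> real) set" +
  fixes L :: "('a \<Rightarrow> real) \<Rightarrow> real"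
  assumes L_add: "\<And>X Y. X \<in> H \<Longrightarrow> Y \<in> H \<Longrightarrow> L (\<lambda>\<omega>. X \<omega> + Y \<omega>) = L X + L Y"
    and L_scale: "\<And>X c. X \<in> H \<Longrightarrow> L (\<lambda>\<omega>. c * X \<omega>) = c * L X"
    and L_nonneg: "\<And>X. X \<in> H \<Longrightarrow> (\<And>\<omega>. 0 \<le> X \<omega>) \<Longrightarrow> 0 \<le> L X"
    and L_continuous: "\<And>X. (\<And>i::nat. X i \<in> H) \<Longrightarrow> (\<And>\<omega>. decseq (\<lambda>i. X i \<omega>)) \<Longrightarrow>
      (\<And>\<omega>. (\<lambda>i. X i \<omega>) \<longlonglongrightarrow> 0) \<Longrightarrow> (\<lambda>i. L (X i)) \<longlonglongrightarrow> 0"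
    and L_one: "L (\<lambda>_. 1) = 1"
begin

lemma L_const: "L (\<lambda>_. c) = c"
  using L_scale[of "\<lambda>_. 1" c] L_one by (simp add: const_in)

lemma L_diff: "X \<in> H \<Longrightarrow> Y \<in> H \<Longrightarrow> L (\<lambda>\<omega>. X \<omega> - Y \<omega>) = L X - L Y"
  using L_add[of X "\<lambda>\<omega>. -1 * Y \<omega>"] L_scale[of Y "-1"] scale_in[of Y "-1"] by simp

lemma L_sum:
  "finite I \<Longrightarrow> (\<And>i. i \<in> I \<Longrightarrow> X i \<in> H) \<Longrightarrow> L (\<lambda>\<omega>. \<Sum>i\<in>I. X i \<omega>) = (\<Sum>i\<in>I. L (X i))"
proof (induction I rule: finite_induct)
  case empty
  then show ?case by (simp add: L_const)
next
  case (insert a I)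
  then show ?case using L_add[of "X a" "\<lambda>\<omega>. \<Sum>i\<in>I. X i \<omega>"] by (simp add: sum_in)
qed

section \<open>The semiring of strips and its premeasure\<close>

definition strips :: "('a \<times> real) set set" where
  "strips = {strip X Y |X Y. X \<in> H \<and> Y \<in> H}"

lemma strip_in: "X \<in> H \<Longrightarrow> Y \<in> H \<Longrightarrow> strip X Y \<in> strips"
  by (auto simp: strips_def)

lemma height_in: "A \<in> strips \<Longrightarrow> height A \<in> H"
proof -
  assume "A \<in> strips"
  then obtain X Y where "A = strip X Y" "X \<in> H" "Y \<in> H" by (auto simp: strips_def)
  then have "height A = (\<lambda>\<omega>. max 0 (Y \<omega> - X \<omega>))" by (auto simp: height_strip)
  also have "\<dots> \<in> H" using \<open>X \<in> H\<close> \<open>Y \<in> H\<close> by (intro lattice_intros)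
  finally show ?thesis .
qed

lemma height_nonneg: "0 \<le> height A \<omega>"
  by (simp add: height_def)

lemma semiring_strips: "semiring_of_sets UNIV strips"
proof
  show "{} \<in> strips"
  proof -
    have "strip (\<lambda>_. 0) (\<lambda>_. 0) = ({} :: ('a \<times> real) set)" by (auto simp: strip_def)
    then show ?thesis using strip_in[OF const_in const_in, of 0 0] by simp
  qed
next
  fix a b assume "a \<in> strips" "b \<in> strips"
  then obtain X Y X' Y' where eq: "a = strip X Y" "b = strip X' Y'"
    and H: "X \<in> H" "Y \<in> H" "X' \<in> H" "Y' \<in> H"
    by (auto simp: strips_def)
  have "a \<inter> b = strip (\<lambda>\<omega>. max (X \<omega>) (X' \<omega>)) (\<lambda>\<omega>. min (Y \<omega>) (Y' \<omega>))"
    by (auto simp: strip_def eq)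
  then show "a \<inter> b \<in> strips"
    using H by (simp add: strip_in lattice_intros)
  \<comment> \<open>Removing \<open>b\<close> leaves a piece below \<open>X'\<close> and a piece
    above \<open>Y'\<close>. The maximum of \<open>X'\<close> and \<open>Y'\<close> in the second
    keeps the pieces disjoint where \<open>Y' < X'\<close>, that is, where the section of
    \<open>b\<close> is empty.\<close>
  let ?l = "strip X (\<lambda>\<omega>. min (Y \<omega>) (X' \<omega>))"
  let ?u = "strip (\<lambda>\<omega>. max (X \<omega>) (max (X' \<omega>) (Y' \<omega>))) Y"
  have "?l \<in> strips" "?u \<in> strips"
    using H by (auto intro!: strip_in lattice_intros)
  moreover have "?l \<inter> ?u = {}" "a - b = ?l \<union> ?u"
    by (auto simp: strip_def eq)
  ultimately show "\<exists>C\<subseteq>strips. finite C \<and> disjoint C \<and> a - b = \<Union> C"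
    by (intro exI[of _ "{?l, ?u}"]) (auto simp: disjoint_def)
qed simp

text \<open>Sections of strips are half-open intervals, so countable additivity of Lebesgue measure
  sums the heights pointwise. The remainders decrease pointwise to 0, and continuity of
  \<open>L\<close> turns this into convergence of the values.\<close>

lemma countably_additive_strips: "countably_additive strips (\<lambda>A. ennreal (L (height A)))"
proof (rule countably_additiveI)
  fix A :: "nat \<Rightarrow> ('a \<times> real) set"
  assume A: "range A \<subseteq> strips" "disjoint_family A" "(\<Union>i. A i) \<in> strips"
  let ?U = "\<Union>i. A i"
  have sums: "(\<lambda>i. height (A i) \<omega>) sums height ?U \<omega>" for \<omega>
  proof -
    have sec: "\<exists>a b. {t. (\<omega>, t) \<in> B} = {a..<b}" if "B \<in> strips" for B
      using that by (fastforce simp: strips_def section_strip)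
    have "(\<lambda>i. measure lborel {t. (\<omega>, t) \<in> A i}) sums measure lborel (\<Union>i. {t. (\<omega>, t) \<in> A i})"
    proof (rule measure_UNION)
      show "range (\<lambda>i. {t. (\<omega>, t) \<in> A i}) \<subseteq> sets lborel"
      proof safe
        fix i
        have "A i \<in> strips" using A(1) by auto
        from sec[OF this] show "{t. (\<omega>, t) \<in> A i} \<in> sets lborel" by auto
      qed
      show "disjoint_family (\<lambda>i. {t. (\<omega>, t) \<in> A i})"
        using A(2) by (auto simp: disjoint_family_on_def)
      have "(\<Union>i. {t. (\<omega>, t) \<in> A i}) = {t. (\<omega>, t) \<in> ?U}" by auto
      also obtain a b where "\<dots> = {a..<b}" using sec[OF A(3)] by auto
      finally show "emeasure lborel (\<Union>i. {t. (\<omega>, t) \<in> A i}) \<noteq> \<infinity>"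
        by (cases "a \<le> b") auto
    qed
    moreover have "(\<Union>i. {t. (\<omega>, t) \<in> A i}) = {t. (\<omega>, t) \<in> ?U}" by auto
    ultimately show ?thesis by (simp add: height_def)
  qed
  have hA: "height (A i) \<in> H" for i using A(1) height_in by auto
  have hU: "height ?U \<in> H" using A(3) by (rule height_in)
  define R where "R n \<omega> = height ?U \<omega> - (\<Sum>i<n. height (A i) \<omega>)" for n \<omega>
  have "(\<lambda>n. L (R n)) \<longlonglongrightarrow> 0"
  proof (rule L_continuous)
    show "R n \<in> H" for n unfolding R_def by (intro diff_in hU sum_in hA) auto
    show "decseq (\<lambda>n. R n \<omega>)" for \<omega>
      by (rule decseq_SucI) (simp add: R_def height_nonneg)
    show "(\<lambda>n. R n \<omega>) \<longlonglongrightarrow> 0" for \<omega>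
      using tendsto_diff[OF tendsto_const sums[unfolded sums_def, of \<omega>], of "height ?U \<omega>"]
      by (simp add: R_def)
  qed
  moreover have "L (R n) = L (height ?U) - (\<Sum>i<n. L (height (A i)))" for n
    unfolding R_def by (subst L_diff) (auto simp: hU hA L_sum intro!: sum_in)
  ultimately have "(\<lambda>n. L (height ?U) - (L (height ?U) - (\<Sum>i<n. L (height (A i))))) \<longlonglongrightarrow> L (height ?U) - 0"
    by (intro tendsto_diff) auto
  then have "(\<lambda>i. L (height (A i))) sums L (height ?U)"
    by (simp add: sums_def)
  then show "(\<Sum>i. ennreal (L (height (A i)))) = ennreal (L (height ?U))"
    by (intro sums_unique[symmetric] sums_ennreal[THEN iffD2])
       (auto intro!: L_nonneg hA hU height_nonneg)
qed

section \<open>Extension to a measure and projection to the base space\<close>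

definition strip_measure :: "('a \<times> real) measure" where
  "strip_measure =
    measure_of UNIV strips
      (SOME \<mu>. (\<forall>A\<in>strips. \<mu> A = ennreal (L (height A))) \<and> measure_space UNIV (sigma_sets UNIV strips) \<mu>)"

lemma sets_strip_measure [simp]: "sets strip_measure = sigma_sets UNIV strips"
  and space_strip_measure [simp]: "space strip_measure = UNIV"
  by (simp_all add: strip_measure_def)

lemma strip_measurable: "X \<in> H \<Longrightarrow> Y \<in> H \<Longrightarrow> strip X Y \<in> sets strip_measure"
  by (auto intro: strip_in)

lemma emeasure_strip_measure:
  assumes "X \<in> H" "Y \<in> H" "\<And>\<omega>. X \<omega> \<le> Y \<omega>"
  shows "emeasure strip_measure (strip X Y) = ennreal (L (\<lambda>\<omega>. Y \<omega> - X \<omega>))"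
proof -
  define \<mu> where "\<mu> = (SOME \<mu>. (\<forall>A\<in>strips. \<mu> A = ennreal (L (height A))) \<and>
    measure_space UNIV (sigma_sets UNIV strips) \<mu>)"
  interpret semiring_of_sets UNIV strips by (rule semiring_strips)
  have "positive strips (\<lambda>A. ennreal (L (height A)))"
    using L_const[of 0] by (simp add: positive_def height_def[abs_def])
  \<comment> \<open>Caratheodory's theorem provides an extension of the premeasure, so the
    \<open>SOME\<close> in \<open>strip_measure\<close> does select a measure with the prescribed
    values on strips.\<close>
  from caratheodory[OF this countably_additive_strips]
  have \<mu>: "(\<forall>A\<in>strips. \<mu> A = ennreal (L (height A))) \<and> measure_space UNIV (sigma_sets UNIV strips) \<mu>"
    unfolding \<mu>_def by (rule someI_ex)
  have "emeasure strip_measure (strip X Y) = \<mu> (strip X Y)"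
    unfolding strip_measure_def \<mu>_def[symmetric]
    using \<mu> strip_in[OF assms(1,2)] by (simp add: emeasure_measure_of_conv sigma_sets.Basic)
  also have "\<dots> = ennreal (L (height (strip X Y)))"
    using \<mu> strip_in[OF assms(1,2)] by blast
  also have "height (strip X Y) = (\<lambda>\<omega>. Y \<omega> - X \<omega>)"
    using assms(3) by (auto simp: height_strip max_def)
  finally show ?thesis .
qed

definition unit_strip :: "('a \<times> real) set" where
  "unit_strip = strip (\<lambda>_. 0) (\<lambda>_. 1)"

definition repr_measure :: "'a measure" where
  "repr_measure = distr (restrict_space strip_measure unit_strip) (sigmaH H) fst"

lemma unit_strip_measurable: "unit_strip \<in> sets strip_measure"
  unfolding unit_strip_def by (intro strip_measurable const_in)

text \<open>Inside the unit strip, the preimage of \<open>X > a\<close> is the union over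
  \<open>j\<close> of the strips from 0 to \<open>min 1 (j * max 0 (X - a))\<close>: where
  \<open>X\<close> exceeds \<open>a\<close> the upper boundary reaches 1 for large \<open>j\<close>,
  elsewhere it is 0. These boundaries stay in \<open>H\<close>, whereas an indicator need
  not.\<close>

lemma fst_measurable: "fst \<in> measurable (restrict_space strip_measure unit_strip) (sigmaH H)"
proof (rule measurable_into_sigmaH)
  fix X assume X: "X \<in> H"
  show "(\<lambda>z. X (fst z)) \<in> borel_measurable (restrict_space strip_measure unit_strip)"
    unfolding borel_measurable_iff_greater
  proof
    fix a
    let ?V = "\<lambda>j::nat. \<lambda>\<omega>. min 1 (real j * max 0 (X \<omega> - a))"
    have ex: "\<exists>j::nat. t < min 1 (real j * max 0 (X \<omega> - a))" if "a < X \<omega>" "t < 1" for \<omega> t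
    proof -
      have "0 < X \<omega> - a" using that by simp
      then obtain j :: nat where "1 < real j * (X \<omega> - a)"
        using reals_Archimedean3 by blast
      with that show ?thesis by (intro exI[of _ j]) auto
    qed
    have "a < X \<omega>" if "0 \<le> t" "t < min 1 (real j * max 0 (X \<omega> - a))" for \<omega> t j
      using that by (cases "a < X \<omega>") auto
    then have "{z \<in> space (restrict_space strip_measure unit_strip). a < X (fst z)} =
        (\<Union>j. strip (\<lambda>_. 0) (?V j))"
      using ex by (fastforce simp: space_restrict_space unit_strip_def strip_def)
    moreover have "strip (\<lambda>_. 0) (?V j) \<in> sets strip_measure" for j
      using X by (intro strip_measurable lattice_intros)
    moreover have "strip (\<lambda>_. 0) (?V j) \<subseteq> unit_strip" for j
      by (auto simp: unit_strip_def strip_def)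
    ultimately show "{z \<in> space (restrict_space strip_measure unit_strip). a < X (fst z)} \<in>
        sets (restrict_space strip_measure unit_strip)"
      using unit_strip_measurable
      by (simp add: sets_restrict_space_iff del: sets_strip_measure) auto
  qed
qed

section \<open>Integration against the representing measure\<close>

lemma sets_repr_measure [simp, measurable_cong]: "sets repr_measure = sets (sigmaH H)"
  and space_repr_measure [simp]: "space repr_measure = UNIV"
  by (simp_all add: repr_measure_def)

lemma measurable_repr_measure: "X \<in> H \<Longrightarrow> X \<in> borel_measurable repr_measure"
  using measurable_in by (simp add: measurable_cong_sets[OF sets_repr_measure refl])

lemma emeasure_repr_measure:
  assumes "A \<in> sets (sigmaH H)"
  shows "emeasure repr_measure A = emeasure strip_measure (A \<times> {0..<1})"
proof -
  have "fst -` A \<inter> unit_strip = A \<times> {0..<1}" "A \<times> {0..<1} \<subseteq> unit_strip"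
    by (auto simp: unit_strip_def strip_def)
  then show ?thesis
    unfolding repr_measure_def using unit_strip_measurable
    by (subst emeasure_distr[OF fst_measurable assms])
       (simp add: emeasure_restrict_space space_restrict_space)
qed

lemma prob_space_repr_measure: "prob_space repr_measure"
proof
  have "UNIV \<times> {0..<1} = strip (\<lambda>_::'a. 0) (\<lambda>_. 1)" by (auto simp: strip_def)
  then show "emeasure repr_measure (space repr_measure) = 1"
    using emeasure_repr_measure[of UNIV] sets.top[of "sigmaH H"]
    by (simp add: emeasure_strip_measure const_in L_one)
qed

text \<open>A Markov-type bound for one horizontal layer of \<open>X\<close>: the part between
  \<open>a\<close> and \<open>a + h\<close>, divided by \<open>h\<close>, equals 1 where
  \<open>X\<close> exceeds \<open>a + h\<close>, so the strip below it contains that set times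
  \<open>[0, 1)\<close>.\<close>

lemma repr_measure_greater_le:
  assumes X: "X \<in> H" and h: "0 < h"
  shows "h * measure repr_measure {\<omega>. a + h < X \<omega>} \<le> L (\<lambda>\<omega>. min (max 0 (X \<omega> - a)) h)"
proof -
  interpret prob_space repr_measure by (rule prob_space_repr_measure)
  note [measurable] = measurable_in[OF X]
  let ?T = "\<lambda>\<omega>. (1 / h) * min (max 0 (X \<omega> - a)) h"
  have T: "?T \<in> H" and T': "(\<lambda>\<omega>. min (max 0 (X \<omega> - a)) h) \<in> H"
    by (intro lattice_intros X)+
  have T0: "0 \<le> ?T \<omega>" for \<omega> using h by simp
  have sub: "{\<omega>. a + h < X \<omega>} \<times> {0..<1} \<subseteq> strip (\<lambda>_. 0) ?T"
    using h by (auto simp: strip_def)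
  have mem: "{\<omega>. a + h < X \<omega>} \<in> sets (sigmaH H)"
    using measurable_in[OF X] unfolding borel_measurable_iff_greater by auto
  have "emeasure repr_measure {\<omega>. a + h < X \<omega>} = emeasure strip_measure ({\<omega>. a + h < X \<omega>} \<times> {0..<1})"
    by (rule emeasure_repr_measure[OF mem])
  also have "\<dots> \<le> emeasure strip_measure (strip (\<lambda>_. 0) ?T)"
    by (rule emeasure_mono[OF sub strip_measurable[OF const_in T]])
  also have "\<dots> = ennreal (L ?T)"
    using emeasure_strip_measure[OF const_in T, of 0] T0 by simp
  finally have "measure repr_measure {\<omega>. a + h < X \<omega>} \<le> L ?T"
    using L_nonneg[OF T T0] by (simp add: emeasure_eq_measure)
  also have "L ?T = L (\<lambda>\<omega>. min (max 0 (X \<omega> - a)) h) / h"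
    using L_scale[OF T', of "1/h"] by simp
  finally show ?thesis using h by (simp add: field_simps)
qed

text \<open>\<open>X\<close> is cut into layers of height \<open>h\<close>. The integral of layer
  \<open>k + 1\<close> is at most \<open>h\<close> times the measure of
  \<open>X > (k + 1) * h\<close>, which is at most \<open>L\<close> of layer \<open>k\<close>. After
  this shift only the bottom layer remains, and it costs at most \<open>h\<close>.\<close>

lemma integral_repr_measure_le:
  assumes X: "X \<in> H" and bnd: "\<And>\<omega>. 0 \<le> X \<omega>" "\<And>\<omega>. X \<omega> \<le> c"
  shows "integral\<^sup>L repr_measure X \<le> L X"
proof -
  interpret prob_space repr_measure by (rule prob_space_repr_measure)
  note [measurable] = measurable_in[OF X]
  have c: "0 \<le> c" using bnd order_trans by blast
  have "integral\<^sup>L repr_measure X \<le> L X + (c + 1) * inverse (real (Suc n))" for n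
  proof -
    \<comment> \<open>With \<open>c + 1\<close> in place of \<open>c\<close> the height is positive
      even if \<open>c = 0\<close>, and the \<open>Suc n\<close> layers reach above
      \<open>c\<close>, so they add up to \<open>X\<close>.\<close>
    define h where "h = (c + 1) / real (Suc n)"
    have h: "0 < h" using c by (simp add: h_def)
    define T where "T k \<omega> = min (max 0 (X \<omega> - real k * h)) h" for k \<omega>
    have T_in: "T k \<in> H" for k unfolding T_def by (intro lattice_intros X)
    have sum_T: "(\<Sum>k<m. T k \<omega>) = min (X \<omega>) (real m * h)" for m \<omega>
    proof (induction m)
      case (Suc m)
      then show ?case using h by (simp add: T_def distrib_right)
    qed (simp add: bnd)
    have "X \<omega> \<le> real (Suc n) * h" for \<omega>
      using bnd(2)[of \<omega>] by (simp add: h_def del: of_nat_Suc)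
    then have X_eq: "(\<lambda>\<omega>. \<Sum>k<Suc n. T k \<omega>) = X"
      unfolding sum_T by (simp add: min_absorb1 del: of_nat_Suc)
    have T_int: "integrable repr_measure (T k)" for k
      using h measurable_repr_measure[OF T_in]
      by (intro integrable_const_bound[where B=h]) (auto simp: T_def)
    have T_le: "integral\<^sup>L repr_measure (T k) \<le> h * measure repr_measure {\<omega>. real k * h < X \<omega>}" for k
    proof -
      have mem: "{\<omega>. real k * h < X \<omega>} \<in> sets repr_measure"
        using measurable_in[OF X] unfolding borel_measurable_iff_greater by auto
      then have "integrable repr_measure (\<lambda>\<omega>. h * indicator {\<omega>. real k * h < X \<omega>} \<omega>)"
        by (intro integrable_mult_right integrable_real_indicator) (auto simp: emeasure_eq_measure)
      then have "integral\<^sup>L repr_measure (T k) \<le> integral\<^sup>L repr_measure (\<lambda>\<omega>. h * indicator {\<omega>. real k * h < X \<omega>} \<omega>)"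
        using h by (intro integral_mono T_int) (auto simp: T_def indicator_def)
      also have "\<dots> = h * measure repr_measure {\<omega>. real k * h < X \<omega>}"
        using mem by simp
      finally show ?thesis .
    qed
    have "integral\<^sup>L repr_measure X = (\<Sum>k<Suc n. integral\<^sup>L repr_measure (T k))"
      unfolding X_eq[symmetric] by (rule Bochner_Integration.integral_sum) (rule T_int)
    also have "\<dots> = integral\<^sup>L repr_measure (T 0) + (\<Sum>k<n. integral\<^sup>L repr_measure (T (Suc k)))"
      by (rule sum.lessThan_Suc_shift)
    also have "integral\<^sup>L repr_measure (T 0) \<le> h"
      using h by (intro order_trans[OF T_le[of 0] mult_left_le[OF prob_le_1]]) simp
    also have "(\<Sum>k<n. integral\<^sup>L repr_measure (T (Suc k))) \<le> (\<Sum>k<n. L (T k))"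
    proof (rule sum_mono)
      fix k
      have "integral\<^sup>L repr_measure (T (Suc k)) \<le> h * measure repr_measure {\<omega>. real k * h + h < X \<omega>}"
        using T_le[of "Suc k"] by (simp add: algebra_simps)
      also have "\<dots> \<le> L (T k)"
        using repr_measure_greater_le[OF X h, of "real k * h"] by (simp add: T_def[abs_def])
      finally show "integral\<^sup>L repr_measure (T (Suc k)) \<le> L (T k)" .
    qed
    also have "(\<Sum>k<n. L (T k)) \<le> (\<Sum>k<Suc n. L (T k))"
      using L_nonneg[OF T_in] h by (simp add: T_def)
    also have "\<dots> = L X"
      unfolding X_eq[symmetric] by (rule L_sum[symmetric]) (auto simp: T_in)
    finally show ?thesis
      by (simp add: h_def divide_inverse)
  qed
  moreover have "(\<lambda>n. L X + (c + 1) * inverse (real (Suc n))) \<longlonglongrightarrow> L X + (c + 1) * 0"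
    by (intro tendsto_intros LIMSEQ_inverse_real_of_nat)
  ultimately show ?thesis
    by (intro LIMSEQ_le_const[of _ "L X"]) auto
qed

text \<open>\<open>c - X\<close> again takes values between 0 and \<open>c\<close>; the previous
  inequality for it is the reverse inequality for \<open>X\<close>, since both functionals preserve
  constants.\<close>

lemma integral_repr_measure_bounded:
  assumes X: "X \<in> H" and bnd: "\<And>\<omega>. 0 \<le> X \<omega>" "\<And>\<omega>. X \<omega> \<le> c"
  shows "integrable repr_measure X \<and> integral\<^sup>L repr_measure X = L X"
proof -
  interpret prob_space repr_measure by (rule prob_space_repr_measure)
  note [measurable] = measurable_in[OF X]
  have int: "integrable repr_measure X"
    using bnd by (intro integrable_const_bound[where B=c]) auto
  have "integral\<^sup>L repr_measure (\<lambda>\<omega>. c - X \<omega>) \<le> L (\<lambda>\<omega>. c - X \<omega>)"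
    using bnd by (intro integral_repr_measure_le[where c=c] lattice_intros X) auto
  then have "c - integral\<^sup>L repr_measure X \<le> c - L X"
    using int X prob_space by (simp add: L_diff const_in L_const)
  with integral_repr_measure_le[OF X bnd] int show ?thesis by simp
qed

text \<open>The truncations of \<open>X\<close> at height \<open>n\<close> increase to
  \<open>X\<close>. Monotone convergence handles the integrals, and continuity of \<open>L\<close>
  applies to the excess above \<open>n\<close>, which decreases to 0.\<close>

lemma integral_repr_measure_nonneg:
  assumes X: "X \<in> H" and nonneg: "\<And>\<omega>. 0 \<le> X \<omega>"
  shows "integrable repr_measure X \<and> integral\<^sup>L repr_measure X = L X"
proof -
  interpret prob_space repr_measure by (rule prob_space_repr_measure)
  have m: "X \<in> borel_measurable repr_measure" by (rule measurable_repr_measure[OF X])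
  let ?X = "\<lambda>n::nat. \<lambda>\<omega>. min (X \<omega>) (real n)"
  have X_in: "?X n \<in> H" for n by (intro lattice_intros X)
  have b: "integrable repr_measure (?X n) \<and> integral\<^sup>L repr_measure (?X n) = L (?X n)" for n
    using nonneg by (intro integral_repr_measure_bounded[where c=n] X_in) auto
  have lim: "(\<lambda>n. ?X n \<omega>) \<longlonglongrightarrow> X \<omega>" for \<omega>
  proof (rule tendsto_eventually)
    obtain N :: nat where "X \<omega> \<le> real N" using real_arch_simple by blast
    then show "eventually (\<lambda>n. ?X n \<omega> = X \<omega>) sequentially"
      by (intro eventually_sequentiallyI[of N]) (auto simp: min_def)
  qed
  have "(\<lambda>n. L (\<lambda>\<omega>. X \<omega> - ?X n \<omega>)) \<longlonglongrightarrow> 0"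
  proof (rule L_continuous)
    show "decseq (\<lambda>n. X \<omega> - ?X n \<omega>)" for \<omega> by (auto simp: decseq_def min_def)
    show "(\<lambda>n. X \<omega> - ?X n \<omega>) \<longlonglongrightarrow> 0" for \<omega>
      using tendsto_diff[OF tendsto_const lim, of "X \<omega>" \<omega>] by simp
  qed (intro diff_in X X_in)
  then have "(\<lambda>n. L X - L (\<lambda>\<omega>. X \<omega> - ?X n \<omega>)) \<longlonglongrightarrow> L X - 0"
    by (intro tendsto_intros)
  then have "(\<lambda>n. integral\<^sup>L repr_measure (?X n)) \<longlonglongrightarrow> L X"
    using b by (simp add: L_diff X X_in)
  moreover have "mono (\<lambda>n. ?X n \<omega>)" for \<omega>
    by (auto simp: mono_def min_def)
  ultimately have "has_bochner_integral repr_measure X (L X)"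
    using b lim m
    by (intro has_bochner_integral_monotone_convergence[where f="?X"]) simp_all
  then show ?thesis by (simp add: has_bochner_integral_iff)
qed

lemma integral_repr_measure:
  assumes X: "X \<in> H"
  shows "integrable repr_measure X" "integral\<^sup>L repr_measure X = L X"
proof -
  let ?p = "\<lambda>\<omega>. max 0 (X \<omega>)" and ?n = "\<lambda>\<omega>. max 0 (- X \<omega>)"
  have in_H: "?p \<in> H" "?n \<in> H" by (intro lattice_intros X)+
  note p = integral_repr_measure_nonneg[OF in_H(1)] and n = integral_repr_measure_nonneg[OF in_H(2)]
  have eq: "(\<lambda>\<omega>. ?p \<omega> - ?n \<omega>) = X" by (auto simp: max_def)
  have "integrable repr_measure (\<lambda>\<omega>. ?p \<omega> - ?n \<omega>)" using p n by auto
  then show "integrable repr_measure X" unfolding eq .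
  have "integral\<^sup>L repr_measure (\<lambda>\<omega>. ?p \<omega> - ?n \<omega>) = L (\<lambda>\<omega>. ?p \<omega> - ?n \<omega>)"
    using p n in_H by (simp add: L_diff)
  then show "integral\<^sup>L repr_measure X = L X" unfolding eq .
qed

end

section \<open>Time averages of Koopman operators\<close>

text \<open>Tychonoff: the families \<open>\<lambda>i. x i n\<close> lie in a product of compact
  intervals, so they have a cluster point as \<open>n\<close> grows. One filter has to serve all
  \<open>i\<close>, and for a large index type a common subsequence need not exist.\<close>

lemma generalized_limit:
  fixes x :: "'i \<Rightarrow> nat \<Rightarrow> real"
  assumes bnd: "\<And>i n. \<bar>x i n\<bar> \<le> c i"
  obtains F l where "F \<noteq> bot" "F \<le> sequentially" "\<And>i. (x i \<longlongrightarrow> l i) F"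
proof -
  define K where "K = PiE UNIV (\<lambda>i. {- c i .. c i})"
  let ?x = "\<lambda>n i. x i n"
  have "compactin (product_topology (\<lambda>_. euclidean) UNIV) K"
    unfolding K_def compactin_PiE by simp
  then have "compact K" by (simp add: euclidean_product_topology)
  moreover have "filtermap ?x sequentially \<noteq> bot" by (simp add: filtermap_bot_iff)
  moreover have "eventually (\<lambda>y. y \<in> K) (filtermap ?x sequentially)"
    using bnd by (auto simp: eventually_filtermap K_def abs_le_iff minus_le_iff intro!: always_eventually)
  ultimately obtain l where l: "inf (nhds l) (filtermap ?x sequentially) \<noteq> bot"
    unfolding compact_filter by blast
  \<comment> \<open>\<open>F\<close> passes to infinity along those \<open>n\<close> whose family is
    close to \<open>l\<close>; it is proper because \<open>l\<close> is a cluster point.\<close>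
  define F where "F = inf sequentially (filtercomap ?x (nhds l))"
  have "F \<noteq> bot"
  proof
    assume "F = bot"
    then have "eventually (\<lambda>_. False) F" by simp
    then obtain P Q where PQ: "eventually P sequentially" "eventually Q (nhds l)"
      "\<And>n. P n \<Longrightarrow> Q (?x n) \<Longrightarrow> False"
      unfolding F_def eventually_inf eventually_filtercomap by blast
    have "eventually (\<lambda>y. \<not> Q y) (filtermap ?x sequentially)"
      unfolding eventually_filtermap using PQ(1) by eventually_elim (use PQ(3) in blast)
    with PQ(2) have "eventually (\<lambda>_. False) (inf (nhds l) (filtermap ?x sequentially))"
      unfolding eventually_inf by blast
    with l show False by (simp add: trivial_limit_def)
  qed
  moreover have "F \<le> sequentially" by (simp add: F_def)
  moreover have "(x i \<longlongrightarrow> l i) F" for i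
  proof -
    have "filterlim ?x (nhds l) F"
      unfolding F_def filterlim_def by (meson filtermap_filtercomap filtermap_mono inf_le2 order_trans)
    then show ?thesis
      using continuous_on_tendsto_compose[OF continuous_on_product_coordinates[of i]] by fastforce
  qed
  ultimately show ?thesis by (rule that)
qed

section \<open>Upper and lower averages along orbits\<close>

lemma koopman_funpow: "(koopman f ^^ i) X \<omega> = X ((f ^^ i) \<omega>)"
proof (induction i arbitrary: \<omega>)
  case (Suc i)
  have "(koopman f ^^ Suc i) X \<omega> = (koopman f ^^ i) X (f \<omega>)" by (simp add: koopman_def)
  then show ?case by (simp add: Suc.IH funpow_swap1)
qed simp

lemma time_average_koopman:
  "time_average (koopman f) X n \<omega> = (\<Sum>i<n. X ((f ^^ i) \<omega>)) / real n"
  by (simp add: time_average_def koopman_funpow)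

lemma time_average_uminus:
  "time_average (koopman f) (\<lambda>\<omega>. - X \<omega>) n \<omega> = - time_average (koopman f) X n \<omega>"
  by (simp add: time_average_koopman sum_negf)

text \<open>Reduces statements about lower averages to statements about upper ones.\<close>

lemma upper_average_uminus:
  "upper_average (koopman f) (\<lambda>\<omega>. - X \<omega>) \<omega> = - lower_average (koopman f) X \<omega>"
  unfolding upper_average_def lower_average_def time_average_uminus
  using ereal_Limsup_uminus[of sequentially "\<lambda>n. ereal (time_average (koopman f) X n \<omega>)"] by simp

text \<open>Starting the orbit one step later drops the first term and changes the normalisation:
  \<open>X \<omega> / n\<close> tends to 0 and \<open>(n + 1) / n\<close> to 1. This works at every
  point, also where the limsup is infinite.\<close>

lemma upper_average_invariant:
  "upper_average (koopman f) X (f \<omega>) = upper_average (koopman f) X \<omega>"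
proof -
  let ?A = "\<lambda>n. time_average (koopman f) X n \<omega>"
  have eq: "time_average (koopman f) X n (f \<omega>) =
      - X \<omega> / real n + (real (Suc n) / real n) * ?A (Suc n)" if "n > 0" for n
    using that unfolding time_average_koopman sum.lessThan_Suc_shift
    by (simp add: funpow_swap1 field_simps del: funpow.simps of_nat_Suc) (simp add: funpow_swap1)
  have "upper_average (koopman f) X (f \<omega>) =
      limsup (\<lambda>n. ereal (- X \<omega> / real n) + ereal (real (Suc n) / real n) * ereal (?A (Suc n)))"
    unfolding upper_average_def
    by (rule Limsup_eq, rule eventually_mono[OF eventually_gt_at_top[of 0]]) (simp add: eq)
  also have "\<dots> = ereal 0 + limsup (\<lambda>n. ereal (real (Suc n) / real n) * ereal (?A (Suc n)))"
    by (intro ereal_limsup_lim_add tendsto_ereal) (real_asymp, simp)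
  also have "limsup (\<lambda>n. ereal (real (Suc n) / real n) * ereal (?A (Suc n))) =
      ereal 1 * limsup (\<lambda>n. ereal (?A (Suc n)))"
    by (intro ereal_limsup_lim_mult tendsto_ereal) (real_asymp, simp_all)
  also have "limsup (\<lambda>n. ereal (?A (Suc n))) = upper_average (koopman f) X \<omega>"
    unfolding upper_average_def using limsup_shift[of "\<lambda>n. ereal (?A n)"] by simp
  finally show ?thesis by (simp add: zero_ereal_def[symmetric] one_ereal_def[symmetric])
qed

lemma lower_average_invariant:
  "lower_average (koopman f) X (f \<omega>) = lower_average (koopman f) X \<omega>"
  using upper_average_invariant[of f "\<lambda>\<omega>. - X \<omega>" \<omega>] by (simp add: upper_average_uminus)

lemma tendsto_iff_average_eq:
  "(\<lambda>n. time_average U X n \<omega>) \<longlonglongrightarrow> c \<longleftrightarrow>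
    upper_average U X \<omega> = ereal c \<and> lower_average U X \<omega> = ereal c"
  unfolding upper_average_def lower_average_def
  by (auto simp: tendsto_iff_Liminf_eq_Limsup lim_ereal[symmetric] simp del: lim_ereal)

lemma lower_le_upper_average: "lower_average U X \<omega> \<le> upper_average U X \<omega>"
  unfolding upper_average_def lower_average_def by (rule Liminf_le_Limsup) simp

section \<open>Regular sublinear expectation systems\<close>

locale regular_koopman_system =
  fixes H :: "('a \<Rightarrow> real) set" and E :: "('a \<Rightarrow> real) \<Rightarrow> real" and f :: "'a \<Rightarrow> 'a"
  assumes measurable_f: "f \<in> measurable (sigmaH H) (sigmaH H)"
    and system: "sublinear_expectation_system H (koopman f) E"
    and regular: "regular_expectation H E"
begin

section \<open>Dominated probabilities and quasi-sure properties\<close>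

sublocale function_lattice H
  using system by unfold_locales (simp add: sublinear_expectation_system_def)

lemma compose_in: "X \<in> H \<Longrightarrow> (\<lambda>\<omega>. X (f \<omega>)) \<in> H"
  and E_compose: "X \<in> H \<Longrightarrow> E (\<lambda>\<omega>. X (f \<omega>)) = E X"
  using system
  by (auto simp: sublinear_expectation_system_def sublinear_expectation_def linear_operator_on_def
      koopman_def comp_def)

lemma compose_funpow_in: "X \<in> H \<Longrightarrow> (\<lambda>\<omega>. X ((f ^^ i) \<omega>)) \<in> H"
  and E_compose_funpow: "X \<in> H \<Longrightarrow> E (\<lambda>\<omega>. X ((f ^^ i) \<omega>)) = E X"
proof -
  have *: "X \<in> H \<Longrightarrow> (\<lambda>\<omega>. X ((f ^^ i) \<omega>)) \<in> H \<and> E (\<lambda>\<omega>. X ((f ^^ i) \<omega>)) = E X"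
  proof (induction i)
    case (Suc i)
    then show ?case
      using compose_in[of "\<lambda>\<omega>. X ((f ^^ i) \<omega>)"] E_compose[of "\<lambda>\<omega>. X ((f ^^ i) \<omega>)"]
      by (simp add: funpow_swap1)
  qed simp
  show "X \<in> H \<Longrightarrow> (\<lambda>\<omega>. X ((f ^^ i) \<omega>)) \<in> H"
    and "X \<in> H \<Longrightarrow> E (\<lambda>\<omega>. X ((f ^^ i) \<omega>)) = E X" using * by auto
qed

context
  fixes P assumes P: "P \<in> dominated_probs H E"
begin

lemma dominated_prob_space: "prob_space P"
  and dominated_sets: "sets P = sets (sigmaH H)"
  and dominated_space: "space P = UNIV"
  and dominated_integrable: "X \<in> H \<Longrightarrow> integrable P X"
  and dominated_le: "X \<in> H \<Longrightarrow> integral\<^sup>L P X \<le> E X"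
  using P sets_eq_imp_space_eq[of P "sigmaH H"] by (auto simp: dominated_probs_def)

lemma dominated_abs_le:
  assumes X: "X \<in> H" shows "\<bar>integral\<^sup>L P X\<bar> \<le> E (\<lambda>\<omega>. \<bar>X \<omega>\<bar>)"
  using integral_abs_bound[of P X] dominated_le[OF abs_in[OF X]] by linarith

text \<open>Follows from \<open>E_compose\<close>. This stability takes the place of invariance of
  the individual \<open>P\<close> when null sets are pulled back along \<open>f\<close>.\<close>

lemma distr_dominated: "distr P (sigmaH H) f \<in> dominated_probs H E"
proof -
  have f: "f \<in> measurable P (sigmaH H)"
    using measurable_f by (simp add: measurable_cong_sets[OF dominated_sets refl])
  interpret prob_space P by (rule dominated_prob_space)
  show ?thesis
    using f E_compose
    by (auto simp: dominated_probs_def prob_space_distr integrable_distr_eq integral_distr measurable_in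
        intro: dominated_integrable compose_in)
       (metis compose_in dominated_le)
qed

end

lemma quasi_surelyD:
  assumes "quasi_surely H E Q" "P \<in> dominated_probs H E"
  shows "AE \<omega> in P. Q \<omega>"
proof -
  obtain A where A: "A \<in> sets (sigmaH H)" "\<And>\<omega>. \<omega> \<in> A \<Longrightarrow> Q \<omega>"
    "(SUP P\<in>dominated_probs H E. emeasure P (- A)) = 0"
    using assms(1) by (auto simp: quasi_surely_def)
  have "emeasure P (- A) \<le> (SUP P\<in>dominated_probs H E. emeasure P (- A))"
    by (rule SUP_upper[OF assms(2)])
  with A(3) have "emeasure P (- A) = 0" by simp
  moreover have "- A \<in> sets P"
    using sets.compl_sets[OF A(1)] by (simp add: dominated_sets[OF assms(2)] Compl_eq_Diff_UNIV)
  ultimately show ?thesis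
    using A(2) by (intro AE_I[of _ _ "- A"]) auto
qed

text \<open>A quasi-sure property needs one measurable set that works for all \<open>P\<close>,
  while the exceptional sets of almost sure statements may vary with \<open>P\<close>. Measurability
  lets the set of all points satisfying \<open>Q\<close> be the witness.\<close>

lemma quasi_surelyI:
  assumes "{\<omega>. Q \<omega>} \<in> sets (sigmaH H)" "\<And>P. P \<in> dominated_probs H E \<Longrightarrow> AE \<omega> in P. Q \<omega>"
  shows "quasi_surely H E Q"
proof -
  have "emeasure P (- {\<omega>. Q \<omega>}) = 0" if P: "P \<in> dominated_probs H E" for P
  proof -
    have "{\<omega> \<in> space P. \<not> Q \<omega>} = - {\<omega>. Q \<omega>}" using dominated_space[OF P] by auto
    moreover have "- {\<omega>. Q \<omega>} \<in> sets P"
      using sets.compl_sets[OF assms(1)] by (simp add: dominated_sets[OF P] Compl_eq_Diff_UNIV)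
    ultimately show ?thesis using AE_iff_measurable assms(2)[OF P] by blast
  qed
  \<comment> \<open>If no probability is dominated, the supremum is over the empty set; in
    \<open>ennreal\<close> it is then 0.\<close>
  then have "(SUP P\<in>dominated_probs H E. emeasure P (- {\<omega>. Q \<omega>})) = 0"
    by (cases "dominated_probs H E = {}") (simp_all add: bot_ennreal)
  with assms(1) show ?thesis
    unfolding quasi_surely_def by (intro bexI[of _ "{\<omega>. Q \<omega>}"]) auto
qed

text \<open>Each induction step replaces \<open>P\<close> by its image under \<open>f\<close>, which
  is again dominated; hence \<open>P\<close> is left arbitrary.\<close>

lemma AE_compose:
  assumes Q: "quasi_surely H E Q" and P: "P \<in> dominated_probs H E"
  shows "AE \<omega> in P. Q ((f ^^ i) \<omega>)"
  using P
proof (induction i arbitrary: P)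
  case 0
  then show ?case using quasi_surelyD[OF Q] by simp
next
  case (Suc i)
  have f: "f \<in> measurable P (sigmaH H)"
    using measurable_f by (simp add: measurable_cong_sets[OF dominated_sets[OF Suc.prems] refl])
  show ?case
    using AE_distrD[OF f Suc.IH[OF distr_dominated[OF Suc.prems]]] by (simp add: funpow_swap1)
qed

lemma AE_funpow_invariant:
  assumes "quasi_surely H E (\<lambda>\<omega>. Y (f \<omega>) = Y \<omega>)" "P \<in> dominated_probs H E"
  shows "AE \<omega> in P. \<forall>i. Y ((f ^^ i) \<omega>) = Y \<omega>"
proof -
  have "AE \<omega> in P. \<forall>i. Y (f ((f ^^ i) \<omega>)) = Y ((f ^^ i) \<omega>)"
    unfolding AE_all_countable using AE_compose[OF assms] by blast
  then show ?thesis
  proof eventually_elim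
    case (elim \<omega>)
    show ?case
    proof
      fix i show "Y ((f ^^ i) \<omega>) = Y \<omega>" by (induction i) (use elim in auto)
    qed
  qed
qed

text \<open>
  Hopf's maximal ergodic inequality without the set where the maximum is positive, whose
  indicator need not lie in \<open>H\<close>: with \<open>M\<^sub>n\<close> the maximum of \<open>0\<close> and the first \<open>n\<close> partial sums,
  \<open>M\<^sub>n \<le> M\<^sub>n\<^sub>+\<^sub>1 = W + M\<^sub>n \<circ> f + R\<^sub>n\<close>, where \<open>R\<^sub>n\<close> is the negative part of \<open>W + M\<^sub>n \<circ> f\<close> and
  tends to \<open>0\<close> once some partial sum is positive.
\<close>

lemma integral_nonneg_if_positive_partial_sum:
  assumes P: "P \<in> dominated_probs H E"
    and inv: "\<And>X. X \<in> H \<Longrightarrow> (\<integral>\<omega>. X (f \<omega>) \<partial>P) = integral\<^sup>L P X"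
    and W: "W \<in> H"
    and pos: "AE \<omega> in P. \<exists>n. 0 < (\<Sum>i<n. W ((f ^^ i) \<omega>))"
  shows "0 \<le> integral\<^sup>L P W"
proof -
  note int = dominated_integrable[OF P]
  define M where "M = rec_nat (\<lambda>_. 0) (\<lambda>_ V \<omega>. max 0 (W \<omega> + V (f \<omega>)))"
  have M_0: "M 0 = (\<lambda>_. 0)" and M_Suc: "M (Suc n) = (\<lambda>\<omega>. max 0 (W \<omega> + M n (f \<omega>)))" for n
    by (simp_all add: M_def)
  have M_in: "M n \<in> H" for n
    by (induction n) (auto simp: M_0 M_Suc intro!: lattice_intros W compose_in)
  have M_mono: "M n \<omega> \<le> M (Suc n) \<omega>" for n \<omega>
  proof (induction n arbitrary: \<omega>)
    case (Suc n)
    show ?case unfolding M_Suc[of "Suc n"] M_Suc[of n]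
      using Suc.IH[of "f \<omega>"] unfolding M_Suc[of n] by (intro max.mono add_left_mono) auto
  qed (simp add: M_0 M_Suc)
  then have M_incseq: "incseq (\<lambda>n. M n \<omega>)" for \<omega> by (rule incseq_SucI)
  have M_ge: "(\<Sum>i<n. W ((f ^^ i) \<omega>)) \<le> M n \<omega>" for n \<omega>
  proof (induction n arbitrary: \<omega>)
    case (Suc n)
    show ?case
      using Suc.IH[of "f \<omega>"] unfolding sum.lessThan_Suc_shift M_Suc by (simp add: funpow_swap1)
  qed (simp add: M_0)
  define R where "R n \<omega> = max 0 (- (W \<omega> + M n (f \<omega>)))" for n \<omega>
  have R_nonneg: "0 \<le> R n \<omega>" for n \<omega> by (simp add: R_def)
  have R_in: "R n \<in> H" for n unfolding R_def by (intro lattice_intros W compose_in M_in)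
  have R_decseq: "decseq (\<lambda>n. R n \<omega>)" for \<omega>
    unfolding R_def decseq_def
    using M_incseq[of "f \<omega>"] by (intro allI impI max.mono) (auto simp: incseq_def)
  \<comment> \<open>By invariance \<open>M n\<close> and its composition with \<open>f\<close> have
    the same integral and cancel.\<close>
  have ge: "- integral\<^sup>L P (R n) \<le> integral\<^sup>L P W" for n
  proof -
    have "M n \<omega> \<le> W \<omega> + M n (f \<omega>) + R n \<omega>" for \<omega>
      using M_mono[of n \<omega>] by (simp add: M_Suc R_def max_def split: if_splits)
    then have "integral\<^sup>L P (M n) \<le> integral\<^sup>L P (\<lambda>\<omega>. W \<omega> + M n (f \<omega>) + R n \<omega>)"
      by (intro integral_mono int M_in lattice_intros W compose_in R_in)
    also have "\<dots> = integral\<^sup>L P W + integral\<^sup>L P (M n) + integral\<^sup>L P (R n)"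
      using int[OF W] int[OF compose_in[OF M_in[of n]]] int[OF R_in[of n]] inv[OF M_in[of n]] by simp
    finally show ?thesis by simp
  qed
  have "(\<lambda>n. integral\<^sup>L P (R n)) \<longlonglongrightarrow> integral\<^sup>L P (\<lambda>_. 0)"
  proof (rule integral_dominated_convergence[where w = "R 0"])
    show "AE \<omega> in P. (\<lambda>n. R n \<omega>) \<longlonglongrightarrow> 0"
      using pos
    proof eventually_elim
      case (elim \<omega>)
      then obtain n where n: "0 < (\<Sum>i<n. W ((f ^^ i) \<omega>))" by blast
      \<comment> \<open>The empty sum is not positive, so \<open>n\<close> is a successor. Splitting
        off the first term compares the rest with \<open>M k\<close> at \<open>f \<omega>\<close>;
        so \<open>R k\<close> vanishes at \<open>\<omega>\<close>, and by monotonicity so do all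
        later \<open>R\<close>.\<close>
      then obtain k where k: "n = Suc k" by (cases n) auto
      have "0 < W \<omega> + M k (f \<omega>)"
        using n M_ge[of "f \<omega>" k] unfolding k sum.lessThan_Suc_shift by (simp add: funpow_swap1)
      then have "R k \<omega> = 0" by (simp add: R_def)
      then have "R n \<omega> = 0" if "k \<le> n" for n
        using decseqD[OF R_decseq that, of \<omega>] by (simp add: R_def)
      then show ?case
        by (intro tendsto_eventually eventually_sequentiallyI[of k])
    qed
    show "AE \<omega> in P. norm (R n \<omega>) \<le> R 0 \<omega>" for n
      using decseqD[OF R_decseq le0] R_nonneg by (intro AE_I2) simp
    show "R n \<in> borel_measurable P" for n using int[OF R_in] by auto
  qed (auto intro: int R_in)
  then have "(\<lambda>n. - integral\<^sup>L P (R n)) \<longlonglongrightarrow> - 0" by (intro tendsto_minus) simp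
  then show ?thesis
    using LIMSEQ_le_const2[of _ "- 0" "integral\<^sup>L P W"] ge by simp
qed

text \<open>The preceding inequality is applied to \<open>X - Y + e\<close>. Almost surely
  \<open>Y\<close> is constant along the orbit and is the limsup of the averages of
  \<open>X\<close>, so some average exceeds \<open>Y - e\<close>, and the corresponding partial sum
  is positive.\<close>

lemma integral_upper_average_le:
  assumes P: "P \<in> dominated_probs H E"
    and inv: "\<And>X. X \<in> H \<Longrightarrow> (\<integral>\<omega>. X (f \<omega>) \<partial>P) = integral\<^sup>L P X"
    and X: "X \<in> H" and Y: "Y \<in> H"
    and upper: "quasi_surely H E (\<lambda>\<omega>. upper_average (koopman f) X \<omega> = ereal (Y \<omega>))"
    and Y_inv: "quasi_surely H E (\<lambda>\<omega>. Y (f \<omega>) = Y \<omega>)"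
  shows "integral\<^sup>L P Y \<le> integral\<^sup>L P X"
proof (rule field_le_epsilon)
  fix e :: real assume e: "0 < e"
  interpret prob_space P by (rule dominated_prob_space[OF P])
  have "0 \<le> integral\<^sup>L P (\<lambda>\<omega>. X \<omega> - Y \<omega> + e)"
  proof (rule integral_nonneg_if_positive_partial_sum[OF P inv])
    show "AE \<omega> in P. \<exists>n. 0 < (\<Sum>i<n. X ((f ^^ i) \<omega>) - Y ((f ^^ i) \<omega>) + e)"
      using quasi_surelyD[OF upper P] AE_funpow_invariant[OF Y_inv P]
    proof eventually_elim
      case (elim \<omega>)
      have "\<exists>n>0. Y \<omega> - e < time_average (koopman f) X n \<omega>"
      proof (rule ccontr)
        assume "\<not> ?thesis"
        then have "time_average (koopman f) X n \<omega> \<le> Y \<omega> - e" if "0 < n" for n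
          using that by (meson not_less)
        then have "eventually (\<lambda>n. ereal (time_average (koopman f) X n \<omega>) \<le> ereal (Y \<omega> - e)) sequentially"
          by (intro eventually_mono[OF eventually_gt_at_top[of 0]]) simp
        then have "upper_average (koopman f) X \<omega> \<le> ereal (Y \<omega> - e)"
          unfolding upper_average_def by (rule Limsup_bounded)
        with elim e show False by simp
      qed
      then obtain n where n: "0 < n" "Y \<omega> - e < time_average (koopman f) X n \<omega>" by blast
      then have "0 < (\<Sum>i<n. X ((f ^^ i) \<omega>)) - real n * (Y \<omega> - e)"
        by (simp add: time_average_koopman field_simps)
      also have "\<dots> = (\<Sum>i<n. X ((f ^^ i) \<omega>) - Y ((f ^^ i) \<omega>) + e)"
        using elim by (simp add: sum.distrib sum_subtractf algebra_simps)
      finally show ?case by blast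
    qed
  qed (simp_all add: lattice_intros X Y)
  then show "integral\<^sup>L P Y \<le> integral\<^sup>L P X + e"
    using dominated_integrable[OF P X] dominated_integrable[OF P Y] by (simp add: prob_space)
qed

lemma integral_lower_average_ge:
  assumes P: "P \<in> dominated_probs H E"
    and inv: "\<And>X. X \<in> H \<Longrightarrow> (\<integral>\<omega>. X (f \<omega>) \<partial>P) = integral\<^sup>L P X"
    and X: "X \<in> H" and Y: "Y \<in> H"
    and lower: "quasi_surely H E (\<lambda>\<omega>. lower_average (koopman f) X \<omega> = ereal (Y \<omega>))"
    and Y_inv: "quasi_surely H E (\<lambda>\<omega>. Y (f \<omega>) = Y \<omega>)"
  shows "integral\<^sup>L P X \<le> integral\<^sup>L P Y"
  using integral_upper_average_le[OF P inv uminus_in[OF X] uminus_in[OF Y]] lower Y_inv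
  by (simp add: upper_average_uminus flip: uminus_ereal.simps)

text \<open>
  A limit point of the Cesaro means of \<open>P \<circ> f\<^sup>-\<^sup>n\<close> as functionals on \<open>H\<close>; regularity of \<open>E\<close>
  makes it a Daniell integral.
\<close>

lemma invariant_dominated_prob:
  assumes P: "P \<in> dominated_probs H E"
  obtains Q where "Q \<in> dominated_probs H E"
    "\<And>X. X \<in> H \<Longrightarrow> (\<integral>\<omega>. X (f \<omega>) \<partial>Q) = integral\<^sup>L Q X"
    "\<And>X. X \<in> H \<Longrightarrow> quasi_surely H E (\<lambda>\<omega>. X (f \<omega>) = X \<omega>) \<Longrightarrow> integral\<^sup>L Q X = integral\<^sup>L P X"
proof -
  interpret prob_space P by (rule dominated_prob_space[OF P])
  define I where "I X i = (\<integral>\<omega>. X ((f ^^ i) \<omega>) \<partial>P)" for X :: "'a \<Rightarrow> real" and i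
  define A where "A X n = (\<Sum>i<n. I X i) / real n" for X n
  have int: "integrable P (\<lambda>\<omega>. X ((f ^^ i) \<omega>))" if "X \<in> H" for X i
    by (rule dominated_integrable[OF P compose_funpow_in[OF that]])
  have I_le: "I X i \<le> E X" if "X \<in> H" for X i
    unfolding I_def
    using dominated_le[OF P compose_funpow_in[OF that, of i]] by (simp add: E_compose_funpow[OF that])
  have I_abs: "\<bar>I X i\<bar> \<le> E (\<lambda>\<omega>. \<bar>X \<omega>\<bar>)" if "X \<in> H" for X i
    unfolding I_def
    using dominated_abs_le[OF P compose_funpow_in[OF that, of i]]
    by (simp add: E_compose_funpow[OF abs_in[OF that]])
  have E_abs: "0 \<le> E (\<lambda>\<omega>. \<bar>X \<omega>\<bar>)" if "X \<in> H" for X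
    using I_abs[OF that, of 0] by simp
  have A_abs: "\<bar>A X n\<bar> \<le> E (\<lambda>\<omega>. \<bar>X \<omega>\<bar>)" if "X \<in> H" for X n
  proof -
    have "\<bar>\<Sum>i<n. I X i\<bar> \<le> real n * E (\<lambda>\<omega>. \<bar>X \<omega>\<bar>)"
      using sum_norm_le[of "{..<n}" "I X" "\<lambda>_. E (\<lambda>\<omega>. \<bar>X \<omega>\<bar>)"] I_abs[OF that] by simp
    then show ?thesis
      using E_abs[OF that] by (cases "n = 0") (simp_all add: A_def field_simps)
  qed
  \<comment> \<open>\<open>generalized_limit\<close> asks for a bound at every index, but the bound
    on \<open>A\<close> holds on \<open>H\<close> only; elsewhere the sequence is set to 0, and the
    outer absolute value keeps the bound nonnegative.\<close>
  obtain F l where F: "F \<noteq> bot" "F \<le> sequentially"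
    and l: "\<And>X. ((\<lambda>n. if X \<in> H then A X n else 0) \<longlongrightarrow> l X) F"
    by (rule generalized_limit[of "\<lambda>X n. if X \<in> H then A X n else 0" "\<lambda>X. \<bar>E (\<lambda>\<omega>. \<bar>X \<omega>\<bar>)\<bar>"])
      (auto intro: order_trans[OF A_abs abs_ge_self])
  have lim: "(A X \<longlongrightarrow> l X) F" if "X \<in> H" for X using l[of X] that by simp
  have limI: "l X = c" if "X \<in> H" "(A X \<longlongrightarrow> c) F" for X c
    using tendsto_unique[OF F(1) lim] that by blast
  have eventually_pos: "eventually (\<lambda>n. n > 0) F"
    using F(2) eventually_gt_at_top[of "0::nat"] by (auto simp: le_filter_def)
  have l_le: "l X \<le> E X" if "X \<in> H" for X
  proof (rule tendsto_upperbound[OF lim[OF that] _ F(1)])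
    show "\<forall>\<^sub>F n in F. A X n \<le> E X"
      using eventually_pos
    proof eventually_elim
      case (elim n)
      have "(\<Sum>i<n. I X i) \<le> real n * E X"
        using sum_bounded_above[of "{..<n}" "I X" "E X"] I_le[OF that] by simp
      with elim show ?case by (simp add: A_def field_simps)
    qed
  qed
  have I_nonneg: "0 \<le> I X i" if "\<And>\<omega>. 0 \<le> X \<omega>" for X i
    unfolding I_def using that by (intro Bochner_Integration.integral_nonneg) auto
  interpret daniell_integral H l
  proof
    show "l (\<lambda>\<omega>. X \<omega> + Y \<omega>) = l X + l Y" if "X \<in> H" "Y \<in> H" for X Y
    proof (rule limI[OF add_in[OF that]])
      have "A (\<lambda>\<omega>. X \<omega> + Y \<omega>) = (\<lambda>n. A X n + A Y n)"
        using int[OF that(1)] int[OF that(2)] by (simp add: A_def I_def sum.distrib add_divide_distrib fun_eq_iff)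
      then show "(A (\<lambda>\<omega>. X \<omega> + Y \<omega>) \<longlongrightarrow> l X + l Y) F"
        using tendsto_add[OF lim[OF that(1)] lim[OF that(2)]] by simp
    qed
    show "l (\<lambda>\<omega>. c * X \<omega>) = c * l X" if "X \<in> H" for X c
    proof (rule limI[OF scale_in[OF that]])
      have "A (\<lambda>\<omega>. c * X \<omega>) = (\<lambda>n. c * A X n)"
        by (simp add: A_def I_def sum_distrib_left fun_eq_iff)
      then show "(A (\<lambda>\<omega>. c * X \<omega>) \<longlongrightarrow> c * l X) F"
        using tendsto_mult_left[OF lim[OF that]] by simp
    qed
    show l_nonneg: "0 \<le> l X" if "X \<in> H" "\<And>\<omega>. 0 \<le> X \<omega>" for X
    proof (rule tendsto_lowerbound[OF lim[OF that(1)] _ F(1)])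
      show "\<forall>\<^sub>F n in F. 0 \<le> A X n"
        by (auto simp: A_def intro!: always_eventually divide_nonneg_nonneg sum_nonneg I_nonneg that)
    qed
    show "(\<lambda>i. l (X i)) \<longlonglongrightarrow> 0"
      if X: "\<And>i::nat. X i \<in> H" "\<And>\<omega>. decseq (\<lambda>i. X i \<omega>)" "\<And>\<omega>. (\<lambda>i. X i \<omega>) \<longlonglongrightarrow> 0" for X
    proof (rule tendsto_sandwich[of "\<lambda>_. 0" _ _ "\<lambda>i. E (X i)"])
      show "(\<lambda>i. E (X i)) \<longlonglongrightarrow> 0"
        using regular X by (auto simp: regular_expectation_def)
      have "0 \<le> X i \<omega>" for i \<omega> using decseq_ge[OF X(2,3)] .
      then show "\<forall>\<^sub>F i in sequentially. 0 \<le> l (X i)"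
        using l_nonneg X(1) by (intro always_eventually allI) auto
    qed (auto intro: always_eventually l_le X(1))
    show "l (\<lambda>_. 1) = 1"
    proof (rule limI[OF const_in])
      have "\<forall>\<^sub>F n in F. A (\<lambda>_. 1) n = 1"
        using eventually_pos by eventually_elim (simp add: A_def I_def prob_space)
      then show "(A (\<lambda>_. 1) \<longlongrightarrow> 1) F" by (rule tendsto_eventually)
    qed
  qed
  have "repr_measure \<in> dominated_probs H E"
    using prob_space_repr_measure l_le by (auto simp: dominated_probs_def integral_repr_measure)
  moreover have "(\<integral>\<omega>. X (f \<omega>) \<partial>repr_measure) = integral\<^sup>L repr_measure X" if X: "X \<in> H" for X
  proof -
    \<comment> \<open>The two sums differ by a first and a last term only. Both are bounded by
      \<open>E\<close> of the absolute value of \<open>X\<close>, so their share of the average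
      tends to 0 and the limit is invariant.\<close>
    have eq: "A (\<lambda>\<omega>. X (f \<omega>)) n = A X n + (I X n - I X 0) / real n" for n
    proof -
      have "I (\<lambda>\<omega>. X (f \<omega>)) i = I X (Suc i)" for i by (simp add: I_def)
      moreover have "(\<Sum>i<n. I X (Suc i)) = (\<Sum>i<n. I X i) + (I X n - I X 0)"
        using sum_lessThan_telescope[of "I X" n] by (simp add: sum_subtractf)
      ultimately show ?thesis by (simp add: A_def add_divide_distrib)
    qed
    have "(\<lambda>n. (I X n - I X 0) / real n) \<longlonglongrightarrow> 0"
    proof (rule tendsto_norm_zero_cancel, rule tendsto_sandwich[of "\<lambda>_. 0" _ _ "\<lambda>n. 2 * E (\<lambda>\<omega>. \<bar>X \<omega>\<bar>) / real n"])
      have "\<bar>I X n - I X 0\<bar> \<le> 2 * E (\<lambda>\<omega>. \<bar>X \<omega>\<bar>)" for n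
        using I_abs[OF X, of n] I_abs[OF X, of 0] by linarith
      then show "\<forall>\<^sub>F n in sequentially. norm ((I X n - I X 0) / real n) \<le> 2 * E (\<lambda>\<omega>. \<bar>X \<omega>\<bar>) / real n"
        by (intro always_eventually allI) (simp add: divide_right_mono)
      show "(\<lambda>n. 2 * E (\<lambda>\<omega>. \<bar>X \<omega>\<bar>) / real n) \<longlonglongrightarrow> 0" by (rule lim_const_over_n)
    qed auto
    then have "((\<lambda>n. (I X n - I X 0) / real n) \<longlongrightarrow> 0) F" using F(2) tendsto_mono by blast
    from tendsto_add[OF lim[OF X] this]
    have "l (\<lambda>\<omega>. X (f \<omega>)) = l X"
      using limI[OF compose_in[OF X], of "l X"] by (simp add: eq[abs_def])
    then show ?thesis by (simp add: integral_repr_measure X compose_in)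
  qed
  moreover have "integral\<^sup>L repr_measure X = integral\<^sup>L P X"
    if X: "X \<in> H" and X_inv: "quasi_surely H E (\<lambda>\<omega>. X (f \<omega>) = X \<omega>)" for X
  proof -
    \<comment> \<open>For a q.s. invariant \<open>X\<close> all terms of the Cesaro means agree, so
      the limit keeps the integral under \<open>P\<close>.\<close>
    have I_eq: "I X i = integral\<^sup>L P X" for i
      unfolding I_def using AE_funpow_invariant[OF X_inv P] int[OF X, of i] int[OF X, of 0]
      by (intro integral_cong_AE) auto
    have "\<forall>\<^sub>F n in F. A X n = integral\<^sup>L P X"
      using eventually_pos by eventually_elim (simp add: A_def I_eq)
    then have "l X = integral\<^sup>L P X" using limI[OF X] tendsto_eventually by blast
    then show ?thesis by (simp add: integral_repr_measure X)
  qed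
  ultimately show ?thesis by (rule that)
qed


section \<open>Existence of the limit\<close>

lemma time_average_in: "X \<in> H \<Longrightarrow> time_average (koopman f) X n \<in> H"
  using scale_in[OF sum_in[of "{..<n}" "\<lambda>i \<omega>. X ((f ^^ i) \<omega>)"], of "1 / real n"]
  by (simp add: compose_funpow_in time_average_koopman[abs_def])

lemma measurable_tendsto_set:
  assumes X: "X \<in> H" and Y: "Y \<in> H"
  shows "{\<omega>. (\<lambda>n. time_average (koopman f) X n \<omega>) \<longlonglongrightarrow> Y \<omega>} \<in> sets (sigmaH H)"
proof -
  have [measurable]: "time_average (koopman f) X n \<in> borel_measurable (sigmaH H)" for n
    by (intro measurable_in time_average_in X)
  note [measurable] = measurable_in[OF Y]
  have "{\<omega> \<in> space (sigmaH H). limsup (\<lambda>n. ereal (time_average (koopman f) X n \<omega>)) = ereal (Y \<omega>) \<and>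
      liminf (\<lambda>n. ereal (time_average (koopman f) X n \<omega>)) = ereal (Y \<omega>)} \<in> sets (sigmaH H)"
    by measurable
  then show ?thesis
    by (simp add: tendsto_iff_average_eq upper_average_def lower_average_def)
qed

lemma measurable_eq_set:
  assumes X: "X \<in> H" and Y: "Y \<in> H" shows "{\<omega>. X \<omega> = Y \<omega>} \<in> sets (sigmaH H)"
proof -
  note [measurable] = measurable_in[OF X] measurable_in[OF Y]
  have "{\<omega> \<in> space (sigmaH H). X \<omega> = Y \<omega>} \<in> sets (sigmaH H)" by measurable
  then show ?thesis by simp
qed

text \<open>\<open>G\<close> is invariant at every point, but \<open>Y\<close> represents it only
  q.s.; the representation is therefore used at \<open>\<omega>\<close> and, through
  \<open>AE_compose\<close>, at \<open>f \<omega>\<close>.\<close>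

lemma quasi_surely_invariant_of_average:
  assumes Y: "Y \<in> H" and inv: "\<And>\<omega>. G (f \<omega>) = G \<omega>"
    and eq: "quasi_surely H E (\<lambda>\<omega>. G \<omega> = ereal (Y \<omega>))"
  shows "quasi_surely H E (\<lambda>\<omega>. Y (f \<omega>) = Y \<omega>)"
proof (rule quasi_surelyI)
  show "{\<omega>. Y (f \<omega>) = Y \<omega>} \<in> sets (sigmaH H)"
    by (intro measurable_eq_set compose_in Y)
  show "AE \<omega> in P. Y (f \<omega>) = Y \<omega>" if P: "P \<in> dominated_probs H E" for P
    using quasi_surelyD[OF eq P] AE_compose[OF eq P, of 1]
    by eventually_elim (simp add: inv)
qed

lemma ergodic_theorem:
  assumes X: "X \<in> H"
    and upper: "qs_member H E (upper_average (koopman f) X)"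
    and lower: "qs_member H E (lower_average (koopman f) X)"
  obtains Y where "Y \<in> H" "quasi_surely H E (\<lambda>\<omega>. Y (f \<omega>) = Y \<omega>)"
    "quasi_surely H E (\<lambda>\<omega>. (\<lambda>n. time_average (koopman f) X n \<omega>) \<longlonglongrightarrow> Y \<omega>)"
proof -
  obtain Y where Y: "Y \<in> H" and Y_eq: "quasi_surely H E (\<lambda>\<omega>. upper_average (koopman f) X \<omega> = ereal (Y \<omega>))"
    using upper by (auto simp: qs_member_def)
  obtain Z where Z: "Z \<in> H" and Z_eq: "quasi_surely H E (\<lambda>\<omega>. lower_average (koopman f) X \<omega> = ereal (Z \<omega>))"
    using lower by (auto simp: qs_member_def)
  have Y_inv: "quasi_surely H E (\<lambda>\<omega>. Y (f \<omega>) = Y \<omega>)"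
    by (rule quasi_surely_invariant_of_average[OF Y upper_average_invariant Y_eq])
  have Z_inv: "quasi_surely H E (\<lambda>\<omega>. Z (f \<omega>) = Z \<omega>)"
    by (rule quasi_surely_invariant_of_average[OF Z lower_average_invariant Z_eq])
  have "AE \<omega> in P. (\<lambda>n. time_average (koopman f) X n \<omega>) \<longlonglongrightarrow> Y \<omega>"
    if P: "P \<in> dominated_probs H E" for P
  proof -
    \<comment> \<open>The averages are compared under an invariant \<open>Q\<close>, since
      \<open>P\<close> need not be invariant. As \<open>Y\<close> and \<open>Z\<close> are q.s.
      invariant, the resulting inequality of integrals carries back to \<open>P\<close>.\<close>
    obtain Q where Q: "Q \<in> dominated_probs H E"
      and inv: "\<And>X. X \<in> H \<Longrightarrow> (\<integral>\<omega>. X (f \<omega>) \<partial>Q) = integral\<^sup>L Q X"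
      and Q_eq: "\<And>X. X \<in> H \<Longrightarrow> quasi_surely H E (\<lambda>\<omega>. X (f \<omega>) = X \<omega>) \<Longrightarrow> integral\<^sup>L Q X = integral\<^sup>L P X"
      using invariant_dominated_prob[OF P] by blast
    note int = dominated_integrable[OF P Y] dominated_integrable[OF P Z]
    have "integral\<^sup>L P Y \<le> integral\<^sup>L P Z"
      using integral_upper_average_le[OF Q inv X Y Y_eq Y_inv]
        integral_lower_average_ge[OF Q inv X Z Z_eq Z_inv]
      by (simp add: Q_eq Y Z Y_inv Z_inv)
    \<comment> \<open>Lower averages never exceed upper ones, so \<open>Y - Z\<close> is nonnegative
      almost surely; the inequality of integrals then forces it to vanish.\<close>
    moreover have ge: "AE \<omega> in P. 0 \<le> Y \<omega> - Z \<omega>"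
      using quasi_surelyD[OF Y_eq P] quasi_surelyD[OF Z_eq P]
    proof eventually_elim
      case (elim \<omega>)
      then show ?case using lower_le_upper_average[of "koopman f" X \<omega>] by simp
    qed
    ultimately have "integral\<^sup>L P (\<lambda>\<omega>. Y \<omega> - Z \<omega>) = 0"
      using integral_nonneg_AE[OF ge] int by simp
    then have "AE \<omega> in P. Y \<omega> - Z \<omega> = 0"
      using integral_nonneg_eq_0_iff_AE[OF Bochner_Integration.integrable_diff[OF int] ge] by simp
    with quasi_surelyD[OF Y_eq P] quasi_surelyD[OF Z_eq P] show ?thesis
      by eventually_elim (simp add: tendsto_iff_average_eq)
  qed
  then have "quasi_surely H E (\<lambda>\<omega>. (\<lambda>n. time_average (koopman f) X n \<omega>) \<longlonglongrightarrow> Y \<omega>)"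
    by (intro quasi_surelyI measurable_tendsto_set X Y)
  with Y Y_inv show ?thesis by (rule that)
qed

section \<open>Ergodicity and constant time averages\<close>

lemma invariant_time_average:
  assumes X: "X \<in> H" and inv: "quasi_surely H E (\<lambda>\<omega>. X (f \<omega>) = X \<omega>)"
  shows "quasi_surely H E (\<lambda>\<omega>. (\<lambda>n. time_average (koopman f) X n \<omega>) \<longlonglongrightarrow> X \<omega>)"
proof (rule quasi_surelyI[OF measurable_tendsto_set[OF X X]])
  show "AE \<omega> in P. (\<lambda>n. time_average (koopman f) X n \<omega>) \<longlonglongrightarrow> X \<omega>"
    if P: "P \<in> dominated_probs H E" for P
    using AE_funpow_invariant[OF inv P]
  proof eventually_elim
    case (elim \<omega>)
    \<comment> \<open>\<open>X\<close> is constant along the orbit, so every average with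
      \<open>n > 0\<close> equals \<open>X \<omega>\<close>; for \<open>n = 0\<close> the average is
      0 by the convention on division.\<close>
    then show ?case
      by (intro tendsto_eventually eventually_mono[OF eventually_gt_at_top[of 0]])
        (simp add: time_average_koopman)
  qed
qed

lemma quasi_surely_mono:
  assumes "quasi_surely H E Q" "\<And>\<omega>. Q \<omega> \<Longrightarrow> R \<omega>" shows "quasi_surely H E R"
  using assms unfolding quasi_surely_def by blast

text \<open>With \<open>invariant_time_average\<close>, this makes condition (ii) applicable to
  every q.s. invariant \<open>X\<close>; under membership at every point that could fail.\<close>

lemma qs_member_averages:
  assumes "Y \<in> H" "quasi_surely H E (\<lambda>\<omega>. (\<lambda>n. time_average (koopman f) X n \<omega>) \<longlonglongrightarrow> Y \<omega>)"
  shows "qs_member H E (upper_average (koopman f) X)" "qs_member H E (lower_average (koopman f) X)"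
  unfolding qs_member_def
  using assms(1) by (auto intro!: bexI[of _ Y] quasi_surely_mono[OF assms(2)] simp: tendsto_iff_average_eq)

text \<open>The limit given by \<open>ergodic_theorem\<close> is a q.s. invariant element of
  \<open>H\<close>, so ergodicity makes it q.s. constant. Conversely, a q.s. invariant
  \<open>X\<close> is the limit of its own averages, and uniqueness of limits equates it with the
  constant.\<close>

lemma ergodic_iff_constant_time_averages:
  "ergodic_system H (koopman f) E \<longleftrightarrow>
    (\<forall>X\<in>H. qs_member H E (upper_average (koopman f) X) \<and>
            qs_member H E (lower_average (koopman f) X) \<longrightarrow>
       (\<exists>c. quasi_surely H E (\<lambda>\<omega>. (\<lambda>n. time_average (koopman f) X n \<omega>) \<longlonglongrightarrow> c)))"
proof safe
  fix X assume erg: "ergodic_system H (koopman f) E" and X: "X \<in> H"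
    and mem: "qs_member H E (upper_average (koopman f) X)" "qs_member H E (lower_average (koopman f) X)"
  obtain Y where Y: "Y \<in> H" "quasi_surely H E (\<lambda>\<omega>. Y (f \<omega>) = Y \<omega>)"
    and lim: "quasi_surely H E (\<lambda>\<omega>. (\<lambda>n. time_average (koopman f) X n \<omega>) \<longlonglongrightarrow> Y \<omega>)"
    using ergodic_theorem[OF X mem] .
  then obtain c where c: "quasi_surely H E (\<lambda>\<omega>. Y \<omega> = c)"
    using erg by (auto simp: ergodic_system_def koopman_def)
  have "quasi_surely H E (\<lambda>\<omega>. (\<lambda>n. time_average (koopman f) X n \<omega>) \<longlonglongrightarrow> c)"
  proof (rule quasi_surelyI[OF measurable_tendsto_set[OF X const_in]])
    show "AE \<omega> in P. (\<lambda>n. time_average (koopman f) X n \<omega>) \<longlonglongrightarrow> c"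
      if P: "P \<in> dominated_probs H E" for P
      using quasi_surelyD[OF lim P] quasi_surelyD[OF c P] by eventually_elim simp
  qed
  then show "\<exists>c. quasi_surely H E (\<lambda>\<omega>. (\<lambda>n. time_average (koopman f) X n \<omega>) \<longlonglongrightarrow> c)" ..
next
  assume const: "\<forall>X\<in>H. qs_member H E (upper_average (koopman f) X) \<and>
      qs_member H E (lower_average (koopman f) X) \<longrightarrow>
      (\<exists>c. quasi_surely H E (\<lambda>\<omega>. (\<lambda>n. time_average (koopman f) X n \<omega>) \<longlonglongrightarrow> c))"
  show "ergodic_system H (koopman f) E"
    unfolding ergodic_system_def
  proof (intro ballI impI)
    fix X assume X: "X \<in> H" and "quasi_surely H E (\<lambda>\<omega>. koopman f X \<omega> = X \<omega>)"
    then have lim: "quasi_surely H E (\<lambda>\<omega>. (\<lambda>n. time_average (koopman f) X n \<omega>) \<longlonglongrightarrow> X \<omega>)"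
      by (intro invariant_time_average) (simp_all add: koopman_def)
    with const X obtain c
      where c: "quasi_surely H E (\<lambda>\<omega>. (\<lambda>n. time_average (koopman f) X n \<omega>) \<longlonglongrightarrow> c)"
      using qs_member_averages[OF X lim] by blast
    have "quasi_surely H E (\<lambda>\<omega>. X \<omega> = c)"
    proof (rule quasi_surelyI[OF measurable_eq_set[OF X const_in]])
      show "AE \<omega> in P. X \<omega> = c" if P: "P \<in> dominated_probs H E" for P
        using quasi_surelyD[OF lim P] quasi_surelyD[OF c P]
        by eventually_elim (rule LIMSEQ_unique)
    qed
    then show "\<exists>c. quasi_surely H E (\<lambda>\<omega>. X \<omega> = c)" ..
  qed
qed

section \<open>Integrals under invariant probabilities\<close>

lemma integral_compose_invariant_prob:
  assumes P: "P \<in> dominated_probs H E" and inv: "invariant_prob H f P" and X: "X \<in> H"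
  shows "(\<integral>\<omega>. X (f \<omega>) \<partial>P) = integral\<^sup>L P X"
proof -
  interpret prob_space P by (rule dominated_prob_space[OF P])
  have f: "f \<in> measurable P P"
    using measurable_f by (simp add: measurable_cong_sets[OF dominated_sets[OF P] dominated_sets[OF P]])
  have "distr P P f = P"
  proof (rule measure_eqI)
    fix A assume "A \<in> sets (distr P P f)"
    then show "emeasure (distr P P f) A = emeasure P A"
      using inv f
      by (simp add: emeasure_distr emeasure_eq_measure invariant_prob_def dominated_sets[OF P] dominated_space[OF P])
  qed simp
  moreover have "X \<in> borel_measurable P"
    using dominated_integrable[OF P X] by auto
  ultimately show ?thesis
    using integral_distr[OF f, of X] by simp
qed

text \<open>The constant \<open>c\<close> represents both the upper and the lower average, so the
  two integral inequalities squeeze the integral of \<open>X\<close> to \<open>c\<close>.\<close>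

lemma integral_eq_constant_time_average:
  assumes P: "P \<in> dominated_probs H E" and inv: "invariant_prob H f P" and X: "X \<in> H"
    and lim: "quasi_surely H E (\<lambda>\<omega>. (\<lambda>n. time_average (koopman f) X n \<omega>) \<longlonglongrightarrow> c)"
  shows "integral\<^sup>L P X = c"
proof -
  interpret prob_space P by (rule dominated_prob_space[OF P])
  note inv' = integral_compose_invariant_prob[OF P inv]
  \<comment> \<open>The invariance condition of those inequalities, instantiated with the constant
    function \<open>c\<close>.\<close>
  have c_inv: "quasi_surely H E (\<lambda>\<omega>. c = c)"
    by (rule quasi_surely_mono[OF lim]) simp
  have "quasi_surely H E (\<lambda>\<omega>. upper_average (koopman f) X \<omega> = ereal c)"
    "quasi_surely H E (\<lambda>\<omega>. lower_average (koopman f) X \<omega> = ereal c)"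
    by (auto intro!: quasi_surely_mono[OF lim] simp: tendsto_iff_average_eq)
  then have "integral\<^sup>L P (\<lambda>_. c) \<le> integral\<^sup>L P X" "integral\<^sup>L P X \<le> integral\<^sup>L P (\<lambda>_. c)"
    using c_inv
    by (blast intro: integral_upper_average_le[OF P inv' X const_in]
        integral_lower_average_ge[OF P inv' X const_in])+
  then show ?thesis by (simp add: prob_space)
qed

end

theorem theorem1p12:
  fixes H :: "('a \<Rightarrow> real) set" and E :: "('a \<Rightarrow> real) \<Rightarrow> real" and f :: "'a \<Rightarrow> 'a"
  assumes meas: "f \<in> measurable (sigmaH H) (sigmaH H)"
    and sys: "sublinear_expectation_system H (koopman f) E"
    and reg: "regular_expectation H E"
  shows
    "(\<forall>X\<in>H. qs_member H E (upper_average (koopman f) X) \<and>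
             qs_member H E (lower_average (koopman f) X) \<longrightarrow>
        (\<exists>X'\<in>H. quasi_surely H E (\<lambda>\<omega>. koopman f X' \<omega> = X' \<omega>) \<and>
                quasi_surely H E (\<lambda>\<omega>. (\<lambda>n. time_average (koopman f) X n \<omega>) \<longlonglongrightarrow> X' \<omega>)))
     \<and>
     (ergodic_system H (koopman f) E \<longleftrightarrow>
        (\<forall>X\<in>H. qs_member H E (upper_average (koopman f) X) \<and>
                qs_member H E (lower_average (koopman f) X) \<longrightarrow>
           (\<exists>c. quasi_surely H E (\<lambda>\<omega>. (\<lambda>n. time_average (koopman f) X n \<omega>) \<longlonglongrightarrow> c))))
     \<and>
     (ergodic_system H (koopman f) E \<or>
        (\<forall>X\<in>H. qs_member H E (upper_average (koopman f) X) \<and>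
                qs_member H E (lower_average (koopman f) X) \<longrightarrow>
           (\<exists>c. quasi_surely H E (\<lambda>\<omega>. (\<lambda>n. time_average (koopman f) X n \<omega>) \<longlonglongrightarrow> c)))
      \<longrightarrow>
        (\<forall>P\<in>dominated_probs H E. invariant_prob H f P \<longrightarrow>
          (\<forall>X\<in>H. qs_member H E (upper_average (koopman f) X) \<and>
                  qs_member H E (lower_average (koopman f) X) \<longrightarrow>
            (\<forall>c. quasi_surely H E (\<lambda>\<omega>. (\<lambda>n. time_average (koopman f) X n \<omega>) \<longlonglongrightarrow> c) \<longrightarrow>
               (\<integral>\<omega>. X \<omega> \<partial>P) = c))))"
proof -
  interpret regular_koopman_system H E f
    using assms by unfold_locales
  have part1: "\<exists>X'\<in>H. quasi_surely H E (\<lambda>\<omega>. koopman f X' \<omega> = X' \<omega>) \<and>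
      quasi_surely H E (\<lambda>\<omega>. (\<lambda>n. time_average (koopman f) X n \<omega>) \<longlonglongrightarrow> X' \<omega>)"
    if "X \<in> H" "qs_member H E (upper_average (koopman f) X)"
      "qs_member H E (lower_average (koopman f) X)" for X
    using ergodic_theorem[OF that] by (auto simp: koopman_def)
  show ?thesis
    using part1 ergodic_iff_constant_time_averages integral_eq_constant_time_average
    by (intro conjI ballI impI allI) blast+
qed

end
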